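(* Let $\Omega\subset\mathbb R^n$ be open, let $(X,d,z_0)$ be a pointed complete metric space, let $\nu\in\mathbb R^n\setminus\{0\}$, and let $f:\Omega\to X$ be a measurable and essentially separably valued function. Suppose that $f$ is absolutely continuous on almost every compact line segment which is contained in $\Omega$ and parallel to $\nu$. Assume also that the metric directional derivative $\mathrm m\partial_\nu f$ belongs to $L^1_{\mathrm{loc}}(\Omega)$. Then $$\|\partial^{\circ}_\nu f(x)\|_{(\mathrm{Lip}_{z_0}(X))^*}=\mathrm m\partial_\nu f(x)$$ for almost every $x\in\Omega$.
   Context: $f$ is measurable if it is measurable with respect to Lebesgue measurable sets of $\Omega$ and the Borel $\sigma$-algebra of $X$; it is essentially separably valued if $f(\Omega\setminus\Sigma)$ is separable for some Lebesgue null set $\Sigma\subset\Omega$. $f$ is absolutely continuous on almost every line segment parallel to $\nu$ if there is a family $L$ of lines parallel to $\nu$ such that $\mathcal L^n(\Omega\setminus\bigcup L)=0$ and, for every $l\in L$, $f$ is absolutely continuous when restricted to any compact line segment contained in $l\cap\Omega$. The metric directional derivative at $x$ is $\mathrm m\partial_\nu f(x)=\lim_{h\to0}\frac{d(f(x+h\nu),f(x))}{|h|}\in[0,\infty)$, when the limit exists. (For $f$ as in the claim it exists at almost every $x\in\Omega$ and is measurable.) $\mathrm{Lip}_{z_0}(X)$ is the Banach space of all real-valued Lipschitz functions on $X$ vanishing at $z_0$, with norm $\mathrm{Lip}(\varphi)=\sup_{x\neq y}|\varphi(x)-\varphi(y)|/d(x,y)$; $(\mathrm{Lip}_{z_0}(X))^*$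 is its Banach dual, and $\langle\varphi,\Lambda\rangle:=\Lambda(\varphi)$. Definition of $\partial^{\circ}_\nu f(x)$: fix a Banach limit $\phi$, i.e. a continuous linear functional $\phi:\ell^\infty\to\mathbb R$ with $\phi(a)=\lim a_m$ whenever the limit exists and $\phi(a)\ge0$ whenever $a_m\ge0$ for all $m$; fix a sequence $\delta_m>0$, $\delta_m\to0$. If there is $C>0$ such that $\limsup_{h\to0}|\varphi(f(x+h\nu))-\varphi(f(x))|/|h|\le C\,\mathrm{Lip}(\varphi)$ for all $\varphi\in\mathrm{Lip}_{z_0}(X)$ (in particular if $\mathrm m\partial_\nu f(x)$ exists), then $\partial^{\circ}_\nu f(x)\in(\mathrm{Lip}_{z_0}(X))^*$ is defined by $$\langle\varphi,\partial^{\circ}_\nu f(x)\rangle:=\phi\left(\left(\frac{\varphi(f(x+\delta_m\nu))-\varphi(f(x))}{\delta_m}\right)_m\right)$$ (the sequence being taken for $m$ large enough that the quotients are defined and bounded, and set to $0$ for the other $m$). *)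

theory Defs
  imports "HOL-Analysis.Analysis"
begin

section \<open>Measurability and absolute continuity on lines\<close>

definition ess_separably_valued ::
    "(real^'n) set \<Rightarrow> (real^'n \<Rightarrow> 'x::metric_space) \<Rightarrow> bool"
  where "ess_separably_valued \<Omega> f \<longleftrightarrow>
    (\<exists>\<Sigma>. \<Sigma> \<subseteq> \<Omega> \<and> \<Sigma> \<in> null_sets lebesgue \<and> separable_space (top_of_set (f ` (\<Omega> - \<Sigma>))))"

text \<open>A family \<open>D\<close> with \<open>D division_of S\<close> is a finite family of nonoverlapping compact intervals
  with union \<open>S\<close>; the endpoints of \<open>k \<in> D\<close> are \<open>Inf k\<close> and \<open>Sup k\<close>.\<close>

definition abs_cont_on_interval :: "(real \<Rightarrow> 'x::metric_space) \<Rightarrow> real \<Rightarrow> real \<Rightarrow> bool"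
  where "abs_cont_on_interval g a b \<longleftrightarrow>
    (\<forall>\<epsilon>>0. \<exists>\<delta>>0. \<forall>D S. D division_of S \<and> S \<subseteq> {a..b} \<and> (\<Sum>k\<in>D. Sup k - Inf k) < \<delta> \<longrightarrow>
       (\<Sum>k\<in>D. dist (g (Inf k)) (g (Sup k))) < \<epsilon>)"

text \<open>Absolute continuity on a segment is tested in the affine parametrization over \<open>{0..1}\<close>; any
  other affine parametrization, such as arc length, only rescales \<open>\<delta>\<close>.\<close>

definition abs_cont_on_segment :: "(real^'n \<Rightarrow> 'x::metric_space) \<Rightarrow> real^'n \<Rightarrow> real^'n \<Rightarrow> bool"
  where "abs_cont_on_segment f p q \<longleftrightarrow> abs_cont_on_interval (\<lambda>t. f (p + t *\<^sub>R (q - p))) 0 1"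

definition abs_cont_on_ae_segment ::
    "(real^'n) set \<Rightarrow> real^'n \<Rightarrow> (real^'n \<Rightarrow> 'x::metric_space) \<Rightarrow> bool"
  where "abs_cont_on_ae_segment \<Omega> \<nu> f \<longleftrightarrow>
    (\<exists>L. (\<forall>l\<in>L. \<exists>p. l = range (\<lambda>t. p + t *\<^sub>R \<nu>)) \<and>
         \<Omega> - \<Union>L \<in> null_sets lebesgue \<and>
         (\<forall>l\<in>L. \<forall>p q. closed_segment p q \<subseteq> l \<inter> \<Omega> \<longrightarrow> abs_cont_on_segment f p q))"

section \<open>The metric directional derivative\<close>

text \<open>Here and below \<open>f\<close> is a total function whose values outside \<open>\<Omega>\<close> are irrelevant:
  for \<open>x\<close> in the open set \<open>\<Omega>\<close> the point \<open>x + h *\<^sub>R \<nu>\<close> lies in \<open>\<Omega>\<close> for all small \<open>h\<close>.\<close>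

definition has_metric_dd ::
    "(real^'n \<Rightarrow> 'x::metric_space) \<Rightarrow> real^'n \<Rightarrow> real^'n \<Rightarrow> real \<Rightarrow> bool"
  where "has_metric_dd f \<nu> x D \<longleftrightarrow>
    ((\<lambda>h. dist (f (x + h *\<^sub>R \<nu>)) (f x) / \<bar>h\<bar>) \<longlongrightarrow> D) (at 0)"

definition metric_dd :: "(real^'n \<Rightarrow> 'x::metric_space) \<Rightarrow> real^'n \<Rightarrow> real^'n \<Rightarrow> real"
  where "metric_dd f \<nu> x = Lim (at 0) (\<lambda>h. dist (f (x + h *\<^sub>R \<nu>)) (f x) / \<bar>h\<bar>)"

definition locally_integrable_on :: "(real^'n \<Rightarrow> real) \<Rightarrow> (real^'n) set \<Rightarrow> bool"
  where "locally_integrable_on g \<Omega> \<longleftrightarrow>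
    (\<forall>K. compact K \<and> K \<subseteq> \<Omega> \<longrightarrow> set_integrable lebesgue K g)"

section \<open>Lipschitz functions vanishing at the base point, and the dual space\<close>

definition Lip0 :: "'x::metric_space \<Rightarrow> ('x \<Rightarrow> real) set"
  where "Lip0 z0 = {\<phi>. (\<exists>C. C-lipschitz_on UNIV \<phi>) \<and> \<phi> z0 = 0}"

text \<open>The pairs with \<open>x = y\<close> contribute \<open>0 / 0 = 0\<close>; they keep the supremum from
  being taken over the empty set when the space is a single point.\<close>

definition Lip_norm :: "('x::metric_space \<Rightarrow> real) \<Rightarrow> real"
  where "Lip_norm \<phi> = (SUP (x, y)\<in>UNIV. \<bar>\<phi> x - \<phi> y\<bar> / dist x y)"

text \<open>Functionals are total functions of which only the values on \<^term>\<open>Lip0 z0\<close> matter.\<close>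

definition Lip0_dual :: "'x::metric_space \<Rightarrow> (('x \<Rightarrow> real) \<Rightarrow> real) set"
  where "Lip0_dual z0 = {\<Lambda>.
    (\<forall>\<phi>\<in>Lip0 z0. \<forall>\<psi>\<in>Lip0 z0. \<Lambda> (\<lambda>y. \<phi> y + \<psi> y) = \<Lambda> \<phi> + \<Lambda> \<psi>) \<and>
    (\<forall>c. \<forall>\<phi>\<in>Lip0 z0. \<Lambda> (\<lambda>y. c * \<phi> y) = c * \<Lambda> \<phi>) \<and>
    (\<exists>C. \<forall>\<phi>\<in>Lip0 z0. \<bar>\<Lambda> \<phi>\<bar> \<le> C * Lip_norm \<phi>)}"

definition Lip0_dual_norm :: "'x::metric_space \<Rightarrow> (('x \<Rightarrow> real) \<Rightarrow> real) \<Rightarrow> real"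
  where "Lip0_dual_norm z0 \<Lambda> = (SUP \<phi>\<in>{\<phi> \<in> Lip0 z0. Lip_norm \<phi> \<le> 1}. \<bar>\<Lambda> \<phi>\<bar>)"

section \<open>The weak directional derivative\<close>

text \<open>The space of bounded sequences is \<^typ>\<open>nat \<Rightarrow>\<^sub>C real\<close>, since \<^typ>\<open>nat\<close> is discrete.
  Shift invariance is deliberately not required.\<close>

definition banach_limit :: "((nat \<Rightarrow>\<^sub>C real) \<Rightarrow> real) \<Rightarrow> bool"
  where "banach_limit \<Phi> \<longleftrightarrow> bounded_linear \<Phi> \<and>
    (\<forall>a l. apply_bcontfun a \<longlonglongrightarrow> l \<longrightarrow> \<Phi> a = l) \<and>
    (\<forall>a. (\<forall>m. 0 \<le> apply_bcontfun a m) \<longrightarrow> 0 \<le> \<Phi> a)"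

definition weak_dd_bounded ::
    "'x::metric_space \<Rightarrow> (real^'n \<Rightarrow> 'x) \<Rightarrow> real^'n \<Rightarrow> real^'n \<Rightarrow> bool"
  where "weak_dd_bounded z0 f \<nu> x \<longleftrightarrow>
    (\<exists>C>0. \<forall>\<phi>\<in>Lip0 z0.
       Limsup (at 0) (\<lambda>h. ereal (\<bar>\<phi> (f (x + h *\<^sub>R \<nu>)) - \<phi> (f x)\<bar> / \<bar>h\<bar>))
         \<le> ereal (C * Lip_norm \<phi>))"

text \<open>The quotients are defined for all large \<open>m\<close>, and the entries where they are not defined are
  set to \<open>0\<close>. Changing finitely many further entries to \<open>0\<close> does not affect the value of a Banach
  limit. Under \<^const>\<open>weak_dd_bounded\<close> the resulting sequence is bounded (see
  \<open>weak_dd_quot_bcontfun\<close> below).\<close>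

definition weak_dd_quot ::
    "(nat \<Rightarrow> real) \<Rightarrow> (real^'n) set \<Rightarrow> (real^'n \<Rightarrow> 'x::metric_space) \<Rightarrow> real^'n \<Rightarrow> real^'n \<Rightarrow>
      ('x \<Rightarrow> real) \<Rightarrow> nat \<Rightarrow> real"
  where "weak_dd_quot \<delta> \<Omega> f \<nu> x \<phi> m =
    (if x + \<delta> m *\<^sub>R \<nu> \<in> \<Omega> then (\<phi> (f (x + \<delta> m *\<^sub>R \<nu>)) - \<phi> (f x)) / \<delta> m else 0)"

definition weak_dd ::
    "((nat \<Rightarrow>\<^sub>C real) \<Rightarrow> real) \<Rightarrow> (nat \<Rightarrow> real) \<Rightarrow> 'x::metric_space \<Rightarrow> (real^'n) set \<Rightarrow>
      (real^'n \<Rightarrow> 'x) \<Rightarrow> real^'n \<Rightarrow> real^'n \<Rightarrow> (('x \<Rightarrow> real) \<Rightarrow> real)"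
  where "weak_dd \<Phi> \<delta> z0 \<Omega> f \<nu> x =
    (if weak_dd_bounded z0 f \<nu> x
     then (\<lambda>\<phi>. \<Phi> (Bcontfun (weak_dd_quot \<delta> \<Omega> f \<nu> x \<phi>)))
     else undefined)"

section \<open>Well-definedness\<close>

lemma Lip_norm_le:
  assumes "C-lipschitz_on UNIV \<phi>" shows "Lip_norm \<phi> \<le> C"
  unfolding Lip_norm_def
proof (rule cSUP_least)
  fix p :: "'a \<times> 'a" assume "p \<in> UNIV"
  obtain x y where p: "p = (x, y)" by force
  have C: "0 \<le> C" "\<bar>\<phi> x - \<phi> y\<bar> \<le> C * dist x y"
    using lipschitz_on_nonneg[OF assms] lipschitz_onD[OF assms, of x y] by (auto simp: dist_real_def)
  show "(case p of (x, y) \<Rightarrow> \<bar>\<phi> x - \<phi> y\<bar> / dist x y) \<le> C"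
    using C by (cases "x = y") (auto simp: p divide_simps)
qed auto

lemma Lip_norm_bound:
  assumes "C-lipschitz_on UNIV \<phi>"
  shows "\<bar>\<phi> x - \<phi> y\<bar> \<le> Lip_norm \<phi> * dist x y"
proof (cases "x = y")
  case False
  have C: "0 \<le> C" using lipschitz_on_nonneg[OF assms] .
  have *: "\<bar>\<phi> u - \<phi> v\<bar> / dist u v \<le> C" for u v
    using lipschitz_onD[OF assms, of u v] C by (cases "u = v") (auto simp: dist_real_def divide_simps)
  have "bdd_above (range (\<lambda>(x, y). \<bar>\<phi> x - \<phi> y\<bar> / dist x y))"
    by (rule bdd_aboveI[of _ C]) (use * in auto)
  then have "(\<lambda>(x, y). \<bar>\<phi> x - \<phi> y\<bar> / dist x y) (x, y) \<le> Lip_norm \<phi>"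
    unfolding Lip_norm_def by (rule cSUP_upper[rotated]) simp
  with False show ?thesis by (simp add: divide_simps)
qed simp

lemma Lip_norm_nonneg:
  assumes "C-lipschitz_on UNIV \<phi>" shows "0 \<le> Lip_norm \<phi>"
proof -
  have C: "0 \<le> C" using lipschitz_on_nonneg[OF assms] .
  have *: "\<bar>\<phi> u - \<phi> v\<bar> / dist u v \<le> C" for u v
    using lipschitz_onD[OF assms, of u v] C by (cases "u = v") (auto simp: dist_real_def divide_simps)
  have "bdd_above (range (\<lambda>(x, y). \<bar>\<phi> x - \<phi> y\<bar> / dist x y))"
    by (rule bdd_aboveI[of _ C]) (use * in auto)
  then have "(\<lambda>(x, y). \<bar>\<phi> x - \<phi> y\<bar> / dist x y) (undefined, undefined) \<le> Lip_norm \<phi>"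
    unfolding Lip_norm_def by (rule cSUP_upper[rotated]) simp
  then show ?thesis by simp
qed

lemma has_metric_dd_imp_weak_dd_bounded:
  assumes "has_metric_dd f \<nu> x D"
  shows "weak_dd_bounded z0 f \<nu> x"
proof -
  have lim: "((\<lambda>h. dist (f (x + h *\<^sub>R \<nu>)) (f x) / \<bar>h\<bar>) \<longlongrightarrow> D) (at 0)"
    using assms by (simp add: has_metric_dd_def)
  have D: "0 \<le> D" by (rule tendsto_lowerbound[OF lim]) auto
  show ?thesis unfolding weak_dd_bounded_def
  proof (intro exI[of _ "D + 1"] conjI ballI)
    fix \<phi> assume "\<phi> \<in> Lip0 z0"
    then obtain C where C: "C-lipschitz_on UNIV \<phi>" by (auto simp: Lip0_def)
    have "eventually (\<lambda>h. dist (f (x + h *\<^sub>R \<nu>)) (f x) / \<bar>h\<bar> < D + 1) (at 0)"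
      using order_tendstoD(2)[OF lim, of "D + 1"] by simp
    then have "eventually (\<lambda>h. ereal (\<bar>\<phi> (f (x + h *\<^sub>R \<nu>)) - \<phi> (f x)\<bar> / \<bar>h\<bar>)
        \<le> ereal ((D + 1) * Lip_norm \<phi>)) (at 0)"
    proof eventually_elim
      case (elim h)
      have "\<bar>\<phi> (f (x + h *\<^sub>R \<nu>)) - \<phi> (f x)\<bar> / \<bar>h\<bar>
          \<le> Lip_norm \<phi> * dist (f (x + h *\<^sub>R \<nu>)) (f x) / \<bar>h\<bar>"
        using Lip_norm_bound[OF C] by (intro divide_right_mono) auto
      also have "\<dots> \<le> Lip_norm \<phi> * (D + 1)"
        using elim Lip_norm_nonneg[OF C] by (metis less_imp_le mult_left_mono times_divide_eq_right)
      finally show ?case by (simp add: mult.commute)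
    qed
    then show "Limsup (at 0) (\<lambda>h. ereal (\<bar>\<phi> (f (x + h *\<^sub>R \<nu>)) - \<phi> (f x)\<bar> / \<bar>h\<bar>))
        \<le> ereal ((D + 1) * Lip_norm \<phi>)"
      by (rule Limsup_bounded)
  qed (use D in simp)
qed

lemma weak_dd_quot_eventually_le:
  assumes \<delta>: "\<And>m. 0 < \<delta> m" "\<delta> \<longlonglongrightarrow> 0" and "e > 0"
    and L: "Limsup (at 0) (\<lambda>h. ereal (\<bar>\<phi> (f (x + h *\<^sub>R \<nu>)) - \<phi> (f x)\<bar> / \<bar>h\<bar>)) \<le> ereal B"
    and B: "0 \<le> B"
  shows "eventually (\<lambda>m. \<bar>weak_dd_quot \<delta> \<Omega> f \<nu> x \<phi> m\<bar> \<le> B + e) sequentially"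
proof -
  have "Limsup (at 0) (\<lambda>h. ereal (\<bar>\<phi> (f (x + h *\<^sub>R \<nu>)) - \<phi> (f x)\<bar> / \<bar>h\<bar>)) < ereal (B + e)"
    by (rule le_less_trans[OF L]) (use \<open>e > 0\<close> in simp)
  then have "eventually (\<lambda>h. ereal (\<bar>\<phi> (f (x + h *\<^sub>R \<nu>)) - \<phi> (f x)\<bar> / \<bar>h\<bar>) < ereal (B + e)) (at 0)"
    by (rule Limsup_lessD)
  moreover have "filterlim \<delta> (at 0) sequentially"
    using \<delta> by (auto simp: filterlim_at intro!: always_eventually less_imp_neq[symmetric])
  ultimately have "eventually (\<lambda>m. ereal (\<bar>\<phi> (f (x + \<delta> m *\<^sub>R \<nu>)) - \<phi> (f x)\<bar> / \<bar>\<delta> m\<bar>) < ereal (B + e)) sequentially"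
    by (rule eventually_compose_filterlim)
  then show ?thesis
    by eventually_elim (use B \<open>e > 0\<close> in \<open>auto simp: weak_dd_quot_def abs_divide\<close>)
qed

lemma weak_dd_quot_bcontfun:
  assumes "\<And>m. 0 < \<delta> m" "\<delta> \<longlonglongrightarrow> 0" "weak_dd_bounded z0 f \<nu> x" "\<phi> \<in> Lip0 z0"
  shows "weak_dd_quot \<delta> \<Omega> f \<nu> x \<phi> \<in> bcontfun"
proof -
  obtain C where C: "C > 0" "Limsup (at 0) (\<lambda>h. ereal (\<bar>\<phi> (f (x + h *\<^sub>R \<nu>)) - \<phi> (f x)\<bar> / \<bar>h\<bar>))
         \<le> ereal (C * Lip_norm \<phi>)"
    using assms(3,4) unfolding weak_dd_bounded_def by blast
  have "0 \<le> Lip_norm \<phi>" using assms(4) Lip_norm_nonneg by (auto simp: Lip0_def)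
  with C have "0 \<le> C * Lip_norm \<phi>" by simp
  then have "eventually (\<lambda>m. \<bar>weak_dd_quot \<delta> \<Omega> f \<nu> x \<phi> m\<bar> \<le> C * Lip_norm \<phi> + 1) sequentially"
    by (intro weak_dd_quot_eventually_le assms C(2)) simp_all
  then have "eventually (\<lambda>m. norm (weak_dd_quot \<delta> \<Omega> f \<nu> x \<phi> m) \<le> C * Lip_norm \<phi> + 1) sequentially"
    by simp
  then have "Bseq (weak_dd_quot \<delta> \<Omega> f \<nu> x \<phi>)"
    by (rule BfunI)
  then show ?thesis by (simp add: bcontfun_def Bseq_eq_bounded)
qed

lemma banach_limit_le:
  assumes "banach_limit \<Phi>" and ev: "eventually (\<lambda>m. \<bar>apply_bcontfun a m\<bar> \<le> B) sequentially"
  shows "\<bar>\<Phi> a\<bar> \<le> B"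
proof -
  note bl = assms(1)[unfolded banach_limit_def]
  interpret bounded_linear \<Phi> using bl by blast
  have key: "\<Phi> u \<le> B" if "eventually (\<lambda>m. apply_bcontfun u m \<le> B) sequentially" for u
  proof -
    let ?v = "\<lambda>m. max (apply_bcontfun u m - B) 0"
    have "bounded (range (apply_bcontfun u))" by (rule bounded_apply_bcontfun)
    then obtain K where K: "\<And>m. \<bar>apply_bcontfun u m\<bar> \<le> K" by (auto simp: bounded_iff)
    have b: "?v \<in> bcontfun"
      unfolding bcontfun_def bounded_iff
    proof (intro CollectI conjI exI[of _ "K + \<bar>B\<bar>"] ballI)
      fix y assume "y \<in> range ?v"
      then obtain m where "y = ?v m" by auto
      then show "norm y \<le> K + \<bar>B\<bar>" using K[of m] by (auto simp: max_def)
    qed simp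
    have v: "apply_bcontfun (Bcontfun ?v) = ?v" by (rule Bcontfun_inverse[OF b])
    have "?v \<longlonglongrightarrow> 0"
      by (rule tendsto_eventually, use that in eventually_elim) auto
    then have 1: "\<Phi> (Bcontfun ?v) = 0" using bl v by metis
    have 2: "\<Phi> (const_bcontfun B) = B"
      using bl by (auto simp: const_bcontfun.rep_eq)
    have "0 \<le> \<Phi> (const_bcontfun B + Bcontfun ?v - u)"
    proof -
      have "0 \<le> apply_bcontfun (const_bcontfun B + Bcontfun ?v - u) m" for m
        by (simp add: v plus_bcontfun.rep_eq minus_bcontfun.rep_eq const_bcontfun.rep_eq)
      then show ?thesis using bl by blast
    qed
    then show ?thesis using 1 2 by (simp add: add diff)
  qed
  have "\<Phi> a \<le> B" by (rule key, use ev in eventually_elim) auto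
  moreover have "\<Phi> (- a) \<le> B"
    by (rule key, use ev in eventually_elim) (auto simp: uminus_bcontfun.rep_eq)
  ultimately show ?thesis by (simp add: neg)
qed

lemma weak_dd_in_Lip0_dual:
  assumes bl: "banach_limit \<Phi>" and \<delta>: "\<And>m. 0 < \<delta> m" "\<delta> \<longlonglongrightarrow> 0"
    and w: "weak_dd_bounded z0 f \<nu> x"
  shows "weak_dd \<Phi> \<delta> z0 \<Omega> f \<nu> x \<in> Lip0_dual z0"
proof -
  let ?q = "weak_dd_quot \<delta> \<Omega> f \<nu> x"
  interpret bounded_linear \<Phi> using bl by (simp add: banach_limit_def)
  have W: "weak_dd \<Phi> \<delta> z0 \<Omega> f \<nu> x = (\<lambda>\<phi>. \<Phi> (Bcontfun (?q \<phi>)))"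
    using w by (simp add: weak_dd_def)
  have inv: "apply_bcontfun (Bcontfun (?q \<phi>)) = ?q \<phi>" if "\<phi> \<in> Lip0 z0" for \<phi>
    by (rule Bcontfun_inverse[OF weak_dd_quot_bcontfun[OF \<delta> w that]])
  have sum: "(\<lambda>y. \<phi> y + \<psi> y) \<in> Lip0 z0" if "\<phi> \<in> Lip0 z0" "\<psi> \<in> Lip0 z0" for \<phi> \<psi>
    using that unfolding Lip0_def by (auto intro: lipschitz_on_add)
  have scale: "(\<lambda>y. c * \<phi> y) \<in> Lip0 z0" if "\<phi> \<in> Lip0 z0" for c \<phi>
    using that lipschitz_on_cmult[of _ UNIV \<phi> c] unfolding Lip0_def by auto
  have 1: "\<Phi> (Bcontfun (?q (\<lambda>y. \<phi> y + \<psi> y))) = \<Phi> (Bcontfun (?q \<phi>)) + \<Phi> (Bcontfun (?q \<psi>))"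
    if "\<phi> \<in> Lip0 z0" "\<psi> \<in> Lip0 z0" for \<phi> \<psi>
  proof -
    have "Bcontfun (?q (\<lambda>y. \<phi> y + \<psi> y)) = Bcontfun (?q \<phi>) + Bcontfun (?q \<psi>)"
      by (rule bcontfun_eqI)
        (simp add: inv that sum plus_bcontfun.rep_eq, simp add: weak_dd_quot_def add_divide_distrib diff_divide_distrib)
    then show ?thesis by (simp add: add)
  qed
  have 2: "\<Phi> (Bcontfun (?q (\<lambda>y. c * \<phi> y))) = c * \<Phi> (Bcontfun (?q \<phi>))" if "\<phi> \<in> Lip0 z0" for c \<phi>
  proof -
    have "Bcontfun (?q (\<lambda>y. c * \<phi> y)) = c *\<^sub>R Bcontfun (?q \<phi>)"
      by (rule bcontfun_eqI)
        (simp add: inv that scale scaleR_bcontfun.rep_eq, simp add: weak_dd_quot_def right_diff_distrib)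
    then show ?thesis by (simp add: scaleR)
  qed
  obtain C where C: "C > 0" "\<And>\<phi>. \<phi> \<in> Lip0 z0 \<Longrightarrow>
      Limsup (at 0) (\<lambda>h. ereal (\<bar>\<phi> (f (x + h *\<^sub>R \<nu>)) - \<phi> (f x)\<bar> / \<bar>h\<bar>)) \<le> ereal (C * Lip_norm \<phi>)"
    using w unfolding weak_dd_bounded_def by blast
  have 3: "\<bar>\<Phi> (Bcontfun (?q \<phi>))\<bar> \<le> C * Lip_norm \<phi>" if "\<phi> \<in> Lip0 z0" for \<phi>
  proof (rule field_le_epsilon)
    fix e :: real assume "e > 0"
    have "0 \<le> Lip_norm \<phi>" using that Lip_norm_nonneg by (auto simp: Lip0_def)
    with C have "0 \<le> C * Lip_norm \<phi>" by simp
    then have "eventually (\<lambda>m. \<bar>?q \<phi> m\<bar> \<le> C * Lip_norm \<phi> + e) sequentially"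
      by (intro weak_dd_quot_eventually_le \<delta> \<open>e > 0\<close> C(2)[OF that])
    then show "\<bar>\<Phi> (Bcontfun (?q \<phi>))\<bar> \<le> C * Lip_norm \<phi> + e"
      by (intro banach_limit_le[OF bl]) (simp add: inv that)
  qed
  show ?thesis unfolding W Lip0_dual_def using 1 2 3 by blast
qed

end

theory Submission
  imports Defs
begin

text \<open>Let \<open>y\<^sub>i\<close> be dense in the essential range of \<open>f\<close>. Along almost every line in direction \<open>\<nu>\<close> the curve
  \<open>\<gamma>\<close> traced by \<open>f\<close> is absolutely continuous, and so are the functions \<open>g\<^sub>i = dist \<gamma> y\<^sub>i\<close>. Since
  \<open>dist (\<gamma> s) (\<gamma> t)\<close> is the supremum of \<open>\<bar>g\<^sub>i s - g\<^sub>i t\<bar>\<close>, Lebesgue differentiation shows that almost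
  everywhere all \<open>g\<^sub>i\<close> are differentiable and the metric derivative of \<open>\<gamma>\<close> is \<open>sup\<^sub>i \<bar>g\<^sub>i'\<bar>\<close>. Fubini carries
  this over to almost every \<open>x\<close>. At such a point the Banach limit of the difference quotients of
  \<open>\<phi>\<^sub>i = dist \<cdot> y\<^sub>i - dist z\<^sub>0 y\<^sub>i\<close> is an honest derivative, so the unit vectors \<open>\<phi>\<^sub>i\<close> already realize the
  metric derivative as the dual norm; the opposite inequality is immediate.\<close>

section \<open>Lebesgue differentiation on the line\<close>

text \<open>The obstacle is Fubini's theorem. Null slices on almost every line determine the size of
  the exceptional set only once this set is known to be measurable, and \<open>dist_regular\<close>
  quantifies over all real \<open>h\<close> and compares two values of a map into a space that need
  not be separable. Hence the detour through \<open>rat_regular\<close>, which sees \<open>f\<close>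
  only through the countably many functions \<open>dist (f x) (y i)\<close> at rational
  displacements. The way back to \<open>dist_regular\<close> needs a curve that is continuous near
  the point and starts in the closure of the \<open>y i\<close>; absolute continuity supplies both
  along almost every whole line.

  A curve in a metric space has no vector derivative to integrate. Its variation dominates the
  distance functions, which therefore have densities by the Radon-Nikodym theorem, and the primitive
  of the supremum of these densities controls the increments of the curve. Curves on compact
  intervals are frozen beyond their endpoints, so that all of this takes place on the whole real
  line.\<close>

text \<open>The intervals on which the increment deviates form a Vitali cover, and Henstock's lemma bounds
  the total length of any disjoint subfamily.\<close>

lemma negligible_large_increment_deviation:
  fixes w G :: "real \<Rightarrow> real"
  assumes G: "\<And>s t. s \<le> t \<Longrightarrow> (w has_integral (G t - G s)) {s..t}" and "c > 0"
  shows "negligible {x \<in> {a<..<b}. \<forall>d>0. \<exists>y. y \<noteq> x \<and> \<bar>y - x\<bar> < d \<and>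
           c * \<bar>y - x\<bar> < \<bar>G y - G x - w x * (y - x)\<bar>}" (is "negligible ?B")
proof (cases "a < b")
  case True
  show ?thesis unfolding negligible_outer_le
  proof (intro allI impI)
    fix e :: real assume "e > 0"
    have intw: "w integrable_on cbox a b"
      using G[of a b] True by auto
    \<comment> \<open>The bound \<open>e * c\<close> is aimed at the end of the proof: every
      interval in \<open>K\<close> deviates by more than \<open>c\<close> times its length, so
      dividing by \<open>c\<close> leaves total length at most \<open>e\<close>.\<close>
    obtain \<gamma> where \<gamma>: "gauge \<gamma>" and hen: "\<And>p. \<lbrakk>p tagged_partial_division_of (cbox a b); \<gamma> fine p\<rbrakk> \<Longrightarrow>
             sum (\<lambda>(x,k). norm(measure lborel k *\<^sub>R w x - integral k w)) p < e * c"
      using Henstock_lemma[OF intw, of "e * c"] \<open>e > 0\<close> \<open>c > 0\<close> by auto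
    \<comment> \<open>The bad point \<open>x\<close> is an endpoint of its interval and serves as
      its tag. \<open>ctr\<close> and \<open>rad\<close> present the segment as a ball, the form in
      which the Vitali theorem is available.\<close>
    define K where "K = {(x, y). x \<in> {a<..<b} \<and> y \<in> {a<..<b} \<and> y \<noteq> x \<and> closed_segment x y \<subseteq> \<gamma> x \<and>
           c * \<bar>y - x\<bar> < \<bar>G y - G x - w x * (y - x)\<bar>}"
    define ctr where "ctr = (\<lambda>(x::real, y). (x + y) / 2)"
    define rad where "rad = (\<lambda>(x::real, y). \<bar>y - x\<bar> / 2)"
    have seg: "cball (ctr (x, y)) (rad (x, y)) = closed_segment x y" for x y
      unfolding ctr_def rad_def cball_eq_atLeastAtMost closed_segment_eq_real_ivl
      by (auto simp: field_simps abs_real_def)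
    have seg': "cball (ctr i) (rad i) = closed_segment (fst i) (snd i)" for i
      by (metis seg prod.collapse)
    obtain C where C: "countable C" "C \<subseteq> K"
      "pairwise (\<lambda>i j. disjnt (cball (ctr i) (rad i)) (cball (ctr j) (rad j))) C"
      "negligible (?B - (\<Union>i \<in> C. cball (ctr i) (rad i)))"
    proof (rule Vitali_covering_theorem_cballs[of K rad ?B ctr])
      show "0 < rad i" if "i \<in> K" for i
        using that by (auto simp: K_def rad_def)
      fix x d :: real assume x: "x \<in> ?B" and "0 < d"
      have "open (\<gamma> x \<inter> {a<..<b})" "x \<in> \<gamma> x \<inter> {a<..<b}"
        using \<gamma> x by (auto simp: gauge_def)
      then obtain r where r: "r > 0" "ball x r \<subseteq> \<gamma> x \<inter> {a<..<b}"
        by (meson open_contains_ball)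
      obtain y where y: "y \<noteq> x" "\<bar>y - x\<bar> < min r d" "c * \<bar>y - x\<bar> < \<bar>G y - G x - w x * (y - x)\<bar>"
      proof -
        have "min r d > 0" using r(1) \<open>0 < d\<close> by simp
        then show ?thesis using x that by blast
      qed
      have "x \<in> ball x r" "y \<in> ball x r" using y r(1) by (auto simp: dist_real_def)
      then have "closed_segment x y \<subseteq> ball x r"
        by (metis convex_ball convex_contains_segment)
      then have "(x, y) \<in> K" using y x r(2) \<open>y \<in> ball x r\<close> unfolding K_def by auto
      moreover have "x \<in> cball (ctr (x, y)) (rad (x, y))" unfolding seg by simp
      moreover have "rad (x, y) < d" using y \<open>0 < d\<close> by (simp add: rad_def)
      ultimately show "\<exists>i. i \<in> K \<and> x \<in> cball (ctr i) (rad i) \<and> rad i < d" by blast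
    qed
    let ?S = "\<lambda>i. closed_segment (fst i) (snd i)"
    have S_cbox: "?S i = cbox (min (fst i) (snd i)) (max (fst i) (snd i))" for i :: "real \<times> real"
      by (auto simp: closed_segment_eq_real_ivl min_def max_def)
    have cont: "measure lebesgue (?S i) = \<bar>snd i - fst i\<bar>" for i :: "real \<times> real"
      unfolding S_cbox by (auto simp: min_def max_def)
    have int: "integral (?S i) w = (if fst i \<le> snd i then G (snd i) - G (fst i) else G (fst i) - G (snd i))"
      for i using G[of "fst i" "snd i"] G[of "snd i" "fst i"]
      by (auto simp: closed_segment_eq_real_ivl intro: integral_unique)
    have disj: "?S i \<inter> ?S j = {}" if "i \<in> C" "j \<in> C" "i \<noteq> j" for i j
      using C(3) that unfolding pairwise_def disjnt_def seg' by blast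
    have fin: "(\<Sum>i\<in>F. \<bar>snd i - fst i\<bar>) \<le> e" if "finite F" "F \<subseteq> C" for F
    proof -
      let ?p = "(\<lambda>i. (fst i, ?S i)) ` F"
      have inj: "inj_on (\<lambda>i. (fst i, ?S i)) F"
        using disj \<open>F \<subseteq> C\<close> by (intro inj_onI) (metis Int_absorb ends_in_segment(1) empty_iff prod.inject subsetD)
      have "?p tagged_partial_division_of cbox a b"
        unfolding tagged_partial_division_of_def
      proof (intro conjI allI impI)
        fix x k assume "(x, k) \<in> ?p"
        then obtain i where i: "i \<in> F" "x = fst i" "k = ?S i" by auto
        show "x \<in> k" "\<exists>a b. k = cbox a b" using i S_cbox by auto
        have "i \<in> K" using i C \<open>F \<subseteq> C\<close> by auto
        then show "k \<subseteq> cbox a b"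
          unfolding i S_cbox by (auto simp: K_def)
      next
        fix x1 K1 x2 K2 assume "(x1, K1) \<in> ?p \<and> (x2, K2) \<in> ?p \<and> (x1, K1) \<noteq> (x2, K2)"
        then obtain i j where "i \<in> F" "j \<in> F" "i \<noteq> j" "K1 = ?S i" "K2 = ?S j" by auto
        then show "interior K1 \<inter> interior K2 = {}"
          using disj[of i j] \<open>F \<subseteq> C\<close> interior_subset[of K1] interior_subset[of K2] by blast
      qed (use that in auto)
      moreover have "\<gamma> fine ?p"
        using \<open>F \<subseteq> C\<close> C(2) by (fastforce simp: fine_def K_def)
      ultimately have "sum (\<lambda>(x,k). norm(measure lborel k *\<^sub>R w x - integral k w)) ?p < e * c"
        by (rule hen)
      then have "(\<Sum>i\<in>F. norm(measure lborel (?S i) *\<^sub>R w (fst i) - integral (?S i) w)) < e * c"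
        by (simp add: sum.reindex[OF inj] o_def)
      moreover have "c * \<bar>snd i - fst i\<bar> \<le> norm(measure lborel (?S i) *\<^sub>R w (fst i) - integral (?S i) w)"
        if "i \<in> F" for i
      proof -
        have "i \<in> K" using that C \<open>F \<subseteq> C\<close> by auto
        then have *: "c * \<bar>snd i - fst i\<bar> < \<bar>G (snd i) - G (fst i) - w (fst i) * (snd i - fst i)\<bar>"
          by (auto simp: K_def)
        have "measure lborel (?S i) = \<bar>snd i - fst i\<bar>"
          unfolding S_cbox by (auto simp: min_def max_def)
        \<comment> \<open>The orientation of the pair only decides the sign of the deviation, which
          the norm removes.\<close>
        then have "measure lborel (?S i) *\<^sub>R w (fst i) - integral (?S i) w =
            (if fst i \<le> snd i then - 1 else 1) * (G (snd i) - G (fst i) - w (fst i) * (snd i - fst i))"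
          unfolding int by (simp add: algebra_simps)
        with * show ?thesis by (cases "fst i \<le> snd i") (simp_all add: abs_mult)
      qed
      ultimately have "(\<Sum>i\<in>F. c * \<bar>snd i - fst i\<bar>) < e * c"
        by (smt (verit) sum_mono)
      then show ?thesis
        using \<open>c > 0\<close> by (simp add: sum_distrib_left[symmetric] mult.commute)
    qed
    have meas: "(\<Union>i\<in>C. ?S i) \<in> lmeasurable" "measure lebesgue (\<Union>i\<in>C. ?S i) \<le> e"
    proof -
      have "measure lebesgue (\<Union>i\<in>F. ?S i) \<le> e" if "F \<subseteq> C" "finite F" for F
      proof -
        have "measure lebesgue (\<Union>i\<in>F. ?S i) \<le> (\<Sum>i\<in>F. measure lebesgue (?S i))"
          by (rule measure_UNION_le) (use that S_cbox in auto)
        then show ?thesis using fin[OF that(2,1)] by (simp add: cont)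
      qed
      moreover have "?S i \<in> lmeasurable" for i :: "real \<times> real" unfolding S_cbox by simp
      ultimately show "(\<Union>i\<in>C. ?S i) \<in> lmeasurable" "measure lebesgue (\<Union>i\<in>C. ?S i) \<le> e"
        using fmeasurable_UN_bound[of C ?S lebesgue e] measure_UN_bound[of C ?S lebesgue e] C(1) by auto
    qed
    define N where "N = ?B - (\<Union>i\<in>C. ?S i)"
    have N: "negligible N" using C(4) unfolding seg' N_def .
    show "\<exists>T. ?B \<subseteq> T \<and> T \<in> lmeasurable \<and> measure lebesgue T \<le> e"
    proof (intro exI conjI)
      show "?B \<subseteq> (\<Union>i\<in>C. ?S i) \<union> N" by (auto simp: N_def)
      show "(\<Union>i\<in>C. ?S i) \<union> N \<in> lmeasurable"
        by (rule fmeasurable.Un[OF meas(1) negligible_imp_measurable[OF N]])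
      have "measure lebesgue ((\<Union>i\<in>C. ?S i) \<union> N) \<le> measure lebesgue (\<Union>i\<in>C. ?S i) + measure lebesgue N"
        using meas(1) negligible_imp_sets[OF N] by (intro measure_Un_le) auto
      then show "measure lebesgue ((\<Union>i\<in>C. ?S i) \<union> N) \<le> e"
        using meas(2) negligible_imp_measure0[OF N] by linarith
    qed
  qed
qed simp

text \<open>If the quotients do not converge to \<open>w x\<close>, they miss it by some
  \<open>inverse (Suc m)\<close> arbitrarily close to \<open>x\<close>. Countably many gaps and
  countably many windows \<open>{- n<..<n}\<close> exhaust the exceptional set; the windows are
  there because Henstock's lemma lives on a compact interval.\<close>

theorem Lebesgue_differentiation_real:
  fixes w G :: "real \<Rightarrow> real"
  assumes G: "\<And>s t. s \<le> t \<Longrightarrow> (w has_integral (G t - G s)) {s..t}"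
  shows "negligible {x. \<not> (G has_real_derivative w x) (at x)}"
proof -
  let ?B = "\<lambda>c n. {x \<in> {- n<..<n}. \<forall>d>0. \<exists>y. y \<noteq> x \<and> \<bar>y - x\<bar> < d \<and>
           c * \<bar>y - x\<bar> < \<bar>G y - G x - w x * (y - x)\<bar>}"
  have "negligible (\<Union>m::nat. \<Union>n::nat. ?B (inverse (Suc m)) (real n))"
    by (intro negligible_Union_nat negligible_large_increment_deviation G) auto
  moreover have "{x. \<not> (G has_real_derivative w x) (at x)} \<subseteq> (\<Union>m::nat. \<Union>n::nat. ?B (inverse (Suc m)) (real n))"
  proof
    fix x assume "x \<in> {x. \<not> (G has_real_derivative w x) (at x)}"
    then have "\<not> ((\<lambda>y. (G y - G x) / (y - x)) \<longlongrightarrow> w x) (at x)"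
      by (simp add: has_field_derivative_iff)
    then obtain e where e: "e > 0" and *: "\<And>d. d > 0 \<Longrightarrow> \<exists>y. y \<noteq> x \<and> \<bar>y - x\<bar> < d \<and> \<bar>(G y - G x) / (y - x) - w x\<bar> \<ge> e"
      unfolding tendsto_iff eventually_at dist_real_def by (force simp: not_less)
    obtain m where m: "inverse (real (Suc m)) < e" using reals_Archimedean[OF e] by auto
    obtain n :: nat where n: "\<bar>x\<bar> < n" using reals_Archimedean2 by auto
    have "x \<in> ?B (inverse (Suc m)) (real n)"
    proof (intro CollectI conjI allI impI)
      show "x \<in> {- real n<..<real n}" using n by auto
      fix d :: real assume "d > 0"
      then obtain y where y: "y \<noteq> x" "\<bar>y - x\<bar> < d" "\<bar>(G y - G x) / (y - x) - w x\<bar> \<ge> e"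
        using * by blast
      have "inverse (Suc m) * \<bar>y - x\<bar> < e * \<bar>y - x\<bar>" using m y(1) by (intro mult_strict_right_mono) auto
      also have "\<dots> \<le> \<bar>(G y - G x) / (y - x) - w x\<bar> * \<bar>y - x\<bar>" using y(3) by (intro mult_right_mono) auto
      also have "\<dots> = \<bar>G y - G x - w x * (y - x)\<bar>"
        using y(1) by (subst abs_mult[symmetric], subst left_diff_distrib) simp
      finally show "\<exists>y. y \<noteq> x \<and> \<bar>y - x\<bar> < d \<and> inverse (Suc m) * \<bar>y - x\<bar> < \<bar>G y - G x - w x * (y - x)\<bar>"
        using y by blast
    qed
    then show "x \<in> (\<Union>m::nat. \<Union>n::nat. ?B (inverse (Suc m)) (real n))" by blast
  qed
  ultimately show ?thesis by (rule negligible_subset)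
qed

section \<open>Absolute continuity, variation and densities\<close>

text \<open>One \<open>\<delta>\<close> for the whole line. A curve on a compact interval acquires
  this property when it is extended by constants, and no interval has to be carried along
  afterwards.\<close>

definition uniformly_abs_cont :: "(real \<Rightarrow> 'x::metric_space) \<Rightarrow> bool"
  where "uniformly_abs_cont g \<longleftrightarrow>
    (\<forall>\<epsilon>>0. \<exists>\<delta>>0. \<forall>D S. D division_of S \<and> (\<Sum>k\<in>D. Sup k - Inf k) < \<delta> \<longrightarrow>
       (\<Sum>k\<in>D. dist (g (Inf k)) (g (Sup k))) < \<epsilon>)"

lemma division_real:
  assumes "D division_of (S::real set)" "k \<in> D"
  shows "k = {Inf k..Sup k}" "Inf k \<le> Sup k"
proof -
  obtain a b where "k = cbox a b" "k \<noteq> {}"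
    using division_ofD(3,4)[OF assms] by blast
  then have "k = {a..b}" "Inf k = a" "Sup k = b" "a \<le> b" by auto
  then show "k = {Inf k..Sup k}" "Inf k \<le> Sup k" by simp_all
qed

text \<open>A set of intervals cannot list the same degenerate interval twice, whereas a family can.\<close>

lemma sum_dist_family_less:
  fixes g :: "real \<Rightarrow> 'x::metric_space"
  assumes D: "\<And>D S. D division_of S \<Longrightarrow> S \<subseteq> T \<Longrightarrow> (\<Sum>k\<in>D. Sup k - Inf k) < \<delta> \<Longrightarrow>
       (\<Sum>k\<in>D. dist (g (Inf k)) (g (Sup k))) < \<epsilon>"
    and "finite I" and st: "\<And>i. i \<in> I \<Longrightarrow> s i \<le> t i" "\<And>i. i \<in> I \<Longrightarrow> {s i..t i} \<subseteq> T"
    and disj: "\<And>i j. i \<in> I \<Longrightarrow> j \<in> I \<Longrightarrow> i \<noteq> j \<Longrightarrow> {s i<..<t i} \<inter> {s j<..<t j} = {}"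
    and len: "(\<Sum>i\<in>I. t i - s i) < \<delta>"
  shows "(\<Sum>i\<in>I. dist (g (s i)) (g (t i))) < \<epsilon>"
proof -
  define J where "J = {i \<in> I. s i < t i}"
  let ?c = "\<lambda>i. {s i..t i}"
  have J: "finite J" "J \<subseteq> I" using \<open>finite I\<close> by (auto simp: J_def)
  have inj: "inj_on ?c J"
  proof (rule inj_onI)
    fix i j assume ij: "i \<in> J" "j \<in> J" "?c i = ?c j"
    then have "{s i<..<t i} \<inter> {s j<..<t j} = {s i<..<t i}" "{s i<..<t i} \<noteq> {}"
      by (auto simp: J_def Icc_eq_Icc)
    then show "i = j" using disj[of i j] ij J by auto
  qed
  have "?c ` J division_of (\<Union>(?c ` J))"
  proof (rule division_ofI)
    fix k assume "k \<in> ?c ` J"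
    then show "k \<subseteq> \<Union>(?c ` J)" "k \<noteq> {}" "\<exists>a b. k = cbox a b"
      by (auto simp: J_def)
  next
    fix k1 k2 assume "k1 \<in> ?c ` J" "k2 \<in> ?c ` J" "k1 \<noteq> k2"
    then obtain i j where "i \<in> J" "j \<in> J" "i \<noteq> j" "k1 = ?c i" "k2 = ?c j" by auto
    then show "interior k1 \<inter> interior k2 = {}" using disj[of i j] J by auto
  qed (use J in auto)
  moreover have "\<Union>(?c ` J) \<subseteq> T" using st J by blast
  moreover have "(\<Sum>k\<in>?c ` J. Sup k - Inf k) = (\<Sum>i\<in>I. t i - s i)"
    unfolding sum.reindex[OF inj] o_def using st
    by (intro sum.mono_neutral_cong_left) (use \<open>finite I\<close> in \<open>force simp: J_def\<close>)+
  ultimately have "(\<Sum>k\<in>?c ` J. dist (g (Inf k)) (g (Sup k))) < \<epsilon>"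
    using D len by simp
  also have "(\<Sum>k\<in>?c ` J. dist (g (Inf k)) (g (Sup k))) = (\<Sum>i\<in>I. dist (g (s i)) (g (t i)))"
    unfolding sum.reindex[OF inj] o_def using st
    by (intro sum.mono_neutral_cong_left) (use \<open>finite I\<close> in \<open>force simp: J_def\<close>)+
  finally show ?thesis .
qed

text \<open>The premise \<open>S \<subseteq> UNIV\<close> gives the rule the shape that
  \<open>sum_dist_family_less\<close> expects, with \<open>T = UNIV\<close>.\<close>

lemma uniformly_abs_contD:
  fixes g :: "real \<Rightarrow> 'x::metric_space"
  assumes "uniformly_abs_cont g" "\<epsilon> > 0"
  obtains \<delta> where "\<delta> > 0" "\<And>D S. D division_of S \<Longrightarrow> S \<subseteq> UNIV \<Longrightarrow> (\<Sum>k\<in>D. Sup k - Inf k) < \<delta> \<Longrightarrow>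
       (\<Sum>k\<in>D. dist (g (Inf k)) (g (Sup k))) < \<epsilon>"
  using assms unfolding uniformly_abs_cont_def by meson

text \<open>A monotone map that stretches lengths by at most \<open>K\<close> sends nonoverlapping
  intervals to nonoverlapping ones, so \<open>\<delta> / K\<close> answers for
  \<open>\<delta>\<close>. Where \<open>c\<close> is constant the images degenerate and may
  coincide, which is why the sum is estimated over a family.\<close>

lemma abs_cont_on_interval_reparametrize:
  fixes g :: "real \<Rightarrow> 'x::metric_space"
  assumes g: "abs_cont_on_interval g a b" and "mono c" and c: "\<And>u. c u \<in> {a..b}"
    and K: "K > 0" "\<And>u v. u \<le> v \<Longrightarrow> c v - c u \<le> K * (v - u)"
  shows "uniformly_abs_cont (\<lambda>u. g (c u))"
  unfolding uniformly_abs_cont_def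
proof (intro allI impI)
  fix \<epsilon> :: real assume "\<epsilon> > 0"
  then obtain \<delta> where "\<delta> > 0" and \<delta>: "\<And>D S. D division_of S \<Longrightarrow> S \<subseteq> {a..b} \<Longrightarrow> (\<Sum>k\<in>D. Sup k - Inf k) < \<delta> \<Longrightarrow>
       (\<Sum>k\<in>D. dist (g (Inf k)) (g (Sup k))) < \<epsilon>"
    using g unfolding abs_cont_on_interval_def by meson
  show "\<exists>\<delta>>0. \<forall>D S. D division_of S \<and> (\<Sum>k\<in>D. Sup k - Inf k) < \<delta> \<longrightarrow>
       (\<Sum>k\<in>D. dist (g (c (Inf k))) (g (c (Sup k)))) < \<epsilon>"
  proof (intro exI[of _ "\<delta> / K"] conjI allI impI)
    fix D and S :: "real set" assume *: "D division_of S \<and> (\<Sum>k\<in>D. Sup k - Inf k) < \<delta> / K"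
    note div = division_real[OF conjunct1[OF *]]
    show "(\<Sum>k\<in>D. dist (g (c (Inf k))) (g (c (Sup k)))) < \<epsilon>"
    proof (rule sum_dist_family_less[OF \<delta>])
      show "finite D" using * by auto
      show "c (Inf k) \<le> c (Sup k)" if "k \<in> D" for k using div that \<open>mono c\<close> by (simp add: mono_def)
      show "{c (Inf k)..c (Sup k)} \<subseteq> {a..b}" if "k \<in> D" for k using c[of "Inf k"] c[of "Sup k"] by auto
      have "(\<Sum>k\<in>D. c (Sup k) - c (Inf k)) \<le> (\<Sum>k\<in>D. K * (Sup k - Inf k))"
        using div K by (intro sum_mono) auto
      also have "\<dots> < \<delta>" using * K
        by (simp add: sum_distrib_left[symmetric] pos_less_divide_eq mult.commute)
      finally show "(\<Sum>k\<in>D. c (Sup k) - c (Inf k)) < \<delta>" .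
      fix k l assume kl: "k \<in> D" "l \<in> D" "k \<noteq> l"
      \<comment> \<open>Disjoint interiors do not order the two intervals if one is a single point,
        which may sit inside the other; the last two alternatives cover this.\<close>
      have ne: "Sup k \<le> Inf l \<or> Sup l \<le> Inf k \<or> Inf k = Sup k \<or> Inf l = Sup l"
      proof -
        have "interior k \<inter> interior l = {}" using * kl division_ofD(5) by blast
        then have "interior {Inf k..Sup k} \<inter> interior {Inf l..Sup l} = {}" using div kl by metis
        then have "{max (Inf k) (Inf l)<..<min (Sup k) (Sup l)} = {}" by (auto simp: set_eq_iff)
        then show ?thesis using div(2)[OF kl(1)] div(2)[OF kl(2)] by (auto simp: max_def min_def split: if_splits)
      qed
      have "x < y" if "c x < c y" for x y using that \<open>mono c\<close> by (meson leD leI monoD)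
      then show "{c (Inf k)<..<c (Sup k)} \<inter> {c (Inf l)<..<c (Sup l)} = {}"
        using ne \<open>mono c\<close>[THEN monoD, of "Sup k" "Inf l"] \<open>mono c\<close>[THEN monoD, of "Sup l" "Inf k"] by auto
    qed auto
  qed (use \<open>\<delta> > 0\<close> K in simp)
qed

section \<open>Variation of a curve through inscribed polygons\<close>

text \<open>The vertices will be weakly monotone total sequences, so truncating them at a point by
  \<open>min\<close> or \<open>max\<close> keeps the number of sides and merely creates sides of
  length zero.\<close>

definition polygon_length :: "(real \<Rightarrow> 'x::metric_space) \<Rightarrow> nat \<Rightarrow> (nat \<Rightarrow> real) \<Rightarrow> real"
  where "polygon_length g n p = (\<Sum>k<n. dist (g (p k)) (g (p (Suc k))))"

text \<open>Vertices are bounded from above only: this is one function on the whole line, whose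
  increments measure the variation in between. \<open>bounded_polygon_length\<close> makes the
  supremum finite for absolutely continuous curves that are constant outside a bounded
  interval.\<close>

definition variation_up_to :: "(real \<Rightarrow> 'x::metric_space) \<Rightarrow> real \<Rightarrow> real"
  where "variation_up_to g t = Sup {polygon_length g n p |n p. mono p \<and> (\<forall>k. p k \<le> t)}"

text \<open>A side crossing \<open>s\<close> is split by the triangle inequality through
  \<open>g s\<close>; every other side survives in one truncation and collapses in the
  other.\<close>

lemma polygon_length_split:
  assumes "mono p"
  shows "polygon_length g n p \<le> polygon_length g n (\<lambda>k. min (p k) s) + polygon_length g n (\<lambda>k. max (p k) s)"
  unfolding polygon_length_def sum.distrib[symmetric]
proof (rule sum_mono)
  fix k
  have "p k \<le> p (Suc k)" using assms by (simp add: mono_def)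
  then show "dist (g (p k)) (g (p (Suc k))) \<le> dist (g (min (p k) s)) (g (min (p (Suc k)) s)) +
      dist (g (max (p k) s)) (g (max (p (Suc k)) s))"
    by (auto simp: min_def max_def intro: dist_triangle)
qed

lemma mono_min_max:
  fixes p :: "nat \<Rightarrow> real"
  assumes "mono p" shows "mono (\<lambda>k. min (p k) s)" "mono (\<lambda>k. max (p k) s)"
  using assms by (auto intro!: monoI min.mono max.mono dest: monoD)

lemma polygon_disjoint:
  fixes p :: "nat \<Rightarrow> real"
  assumes "mono p" "i \<noteq> j"
  shows "{p i<..<p (Suc i)} \<inter> {p j<..<p (Suc j)} = {}"
proof -
  have "p (Suc i) \<le> p j \<or> p (Suc j) \<le> p i"
    using assms by (meson monoD not_less_eq_eq le_antisym nat_le_linear)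
  then show ?thesis by auto
qed

text \<open>A polygon inside a window shorter than \<open>\<delta>\<close> has length at most 1.
  Finitely many windows cover the part between \<open>a\<close> and \<open>b\<close>, and
  \<open>polygon_length_split\<close> adds up their contributions.\<close>

lemma bounded_polygon_length:
  fixes g :: "real \<Rightarrow> 'x::metric_space"
  assumes g: "uniformly_abs_cont g" and a: "\<And>u. u \<le> a \<Longrightarrow> g u = g a" and b: "\<And>u. b \<le> u \<Longrightarrow> g u = g b"
  obtains B where "\<And>n p. mono p \<Longrightarrow> polygon_length g n p \<le> B"
proof -
  obtain \<delta> where \<delta>: "\<delta> > 0" "\<And>D S. D division_of S \<Longrightarrow> S \<subseteq> UNIV \<Longrightarrow> (\<Sum>k\<in>D. Sup k - Inf k) < \<delta> \<Longrightarrow>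
       (\<Sum>k\<in>D. dist (g (Inf k)) (g (Sup k))) < 1"
    using uniformly_abs_contD[OF g zero_less_one] by auto
  have short: "polygon_length g n p \<le> 1" if "mono p" "\<And>k. p k \<in> {u..v}" "v - u < \<delta>" for n p u v
    unfolding polygon_length_def
  proof (rule less_imp_le, rule sum_dist_family_less[OF \<delta>(2)])
    have "(\<Sum>i<n. p (Suc i) - p i) = p n - p 0" by (rule sum_lessThan_telescope)
    then show "(\<Sum>i<n. p (Suc i) - p i) < \<delta>" using that(2)[of n] that(2)[of 0] that(3) by auto
    show "{p i<..<p (Suc i)} \<inter> {p j<..<p (Suc j)} = {}" if "i \<noteq> j" for i j
      using polygon_disjoint \<open>mono p\<close> that by blast
  qed (use \<open>mono p\<close> in \<open>auto simp: mono_def\<close>)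
  \<comment> \<open>Half of \<open>\<delta>\<close>, because absolute continuity asks for total
    length strictly below \<open>\<delta>\<close>.\<close>
  define d where "d = \<delta> / 2"
  have *: "polygon_length g n (\<lambda>k. min (p k) (a + real m * d)) \<le> m" if "mono p" for n m p
  proof (induction m)
    case 0
    have "g (min (p k) a) = g a" for k using a[of "min (p k) a"] by simp
    then show ?case by (simp add: polygon_length_def)
  next
    case (Suc m)
    let ?q = "\<lambda>k. min (p k) (a + real (Suc m) * d)" and ?s = "a + real m * d"
    have "d > 0" using \<delta> by (simp add: d_def)
    have q: "mono ?q" using mono_min_max(1)[OF that] .
    have "(\<lambda>k. min (?q k) ?s) = (\<lambda>k. min (p k) ?s)"
      using \<open>d > 0\<close> by (auto simp: fun_eq_iff min_def algebra_simps)
    moreover have "polygon_length g n (\<lambda>k. max (?q k) ?s) \<le> 1"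
    proof (rule short[OF mono_min_max(2)[OF q]])
      show "max (?q k) ?s \<in> {?s..?s + d}" for k
        using \<open>d > 0\<close> by (auto simp: algebra_simps)
      show "?s + d - ?s < \<delta>" using \<delta> by (simp add: d_def)
    qed
    ultimately show ?case using polygon_length_split[OF q, of g n ?s] Suc by simp
  qed
  obtain m :: nat where m: "(b - a) / d \<le> m" using real_arch_simple by blast
  show ?thesis
  proof
    fix n and p :: "nat \<Rightarrow> real" assume p: "mono p"
    have "b \<le> a + real m * d" using m \<delta> by (simp add: d_def field_simps)
    then have "g (p k) = g (min (p k) (a + real m * d))" for k
      using b[of "p k"] b[of "a + real m * d"] by (auto simp: min_def)
    then show "polygon_length g n p \<le> m" using *[OF p] by (simp add: polygon_length_def)
  qed
qed

lemma variation_up_to_upper: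
  fixes g :: "real \<Rightarrow> 'x::metric_space"
  assumes "\<And>n p. mono p \<Longrightarrow> polygon_length g n p \<le> B" "mono p" "\<And>k. p k \<le> t"
  shows "polygon_length g n p \<le> variation_up_to g t"
  unfolding variation_up_to_def by (rule cSup_upper) (use assms in \<open>auto intro!: bdd_aboveI\<close>)

lemma dist_le_variation_diff:
  fixes g :: "real \<Rightarrow> 'x::metric_space"
  assumes B: "\<And>n p. mono p \<Longrightarrow> polygon_length g n p \<le> B" and "s \<le> t"
  shows "variation_up_to g s + dist (g s) (g t) \<le> variation_up_to g t"
proof -
  have "variation_up_to g s \<le> variation_up_to g t - dist (g s) (g t)"
    unfolding variation_up_to_def[of g s]
  proof (rule cSup_least)
    have "mono (\<lambda>k::nat. s)" by (simp add: mono_def)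
    then show "{polygon_length g n p |n p. mono p \<and> (\<forall>k. p k \<le> s)} \<noteq> {}" by force
    fix x assume "x \<in> {polygon_length g n p |n p. mono p \<and> (\<forall>k. p k \<le> s)}"
    then obtain n p where x: "x = polygon_length g n p" and p: "mono p" "\<And>k. p k \<le> s" by auto
    \<comment> \<open>Two vertices are appended: the side ending at \<open>s\<close> is discarded as
      nonnegative, the side from \<open>s\<close> to \<open>t\<close> is the gain. The constant tail
      keeps \<open>q\<close> monotone and below \<open>t\<close>.\<close>
    define q where "q k = (if k \<le> n then p k else if k = Suc n then s else t)" for k
    have "mono q" unfolding mono_def q_def using p \<open>s \<le> t\<close> by (auto simp: mono_def intro: order_trans)
    moreover have "q k \<le> t" for k using p(2)[of k] \<open>s \<le> t\<close> by (auto simp: q_def)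
    ultimately have "polygon_length g (Suc (Suc n)) q \<le> variation_up_to g t"
      using variation_up_to_upper[OF B] by blast
    moreover have "polygon_length g n q = polygon_length g n p"
      unfolding polygon_length_def by (rule sum.cong) (auto simp: q_def)
    then have "polygon_length g (Suc (Suc n)) q = x + dist (g (p n)) (g s) + dist (g s) (g t)"
      unfolding x by (simp add: polygon_length_def q_def)
    ultimately show "x \<le> variation_up_to g t - dist (g s) (g t)"
      using zero_le_dist[of "g (p n)" "g s"] by linarith
  qed
  then show ?thesis by simp
qed

text \<open>A nearly optimal polygon below \<open>t\<close> is cut at \<open>s\<close>. Its lower
  piece is at most as long as the variation up to \<open>s\<close>, so the upper piece carries the
  difference up to \<open>\<eta>\<close>.\<close>

lemma variation_diff_approx:
  fixes g :: "real \<Rightarrow> 'x::metric_space"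
  assumes B: "\<And>n p. mono p \<Longrightarrow> polygon_length g n p \<le> B" and "s \<le> t" "\<eta> > 0"
  obtains n p where "mono p" "\<And>k. p k \<in> {s..t}"
    "variation_up_to g t - variation_up_to g s < polygon_length g n p + \<eta>"
proof -
  let ?S = "{polygon_length g n p |n p. mono p \<and> (\<forall>k. p k \<le> t)}"
  have "mono (\<lambda>k::nat. t)" by (simp add: mono_def)
  then have "?S \<noteq> {}" by force
  moreover have "variation_up_to g t - \<eta> < Sup ?S" using \<open>\<eta> > 0\<close> by (simp add: variation_up_to_def)
  ultimately obtain x where "x \<in> ?S" "variation_up_to g t - \<eta> < x" by (meson less_cSupE)
  then obtain n p where p: "mono p" "\<And>k. p k \<le> t" "variation_up_to g t - \<eta> < polygon_length g n p" by auto
  have "polygon_length g n (\<lambda>k. min (p k) s) \<le> variation_up_to g s"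
    by (rule variation_up_to_upper[OF B mono_min_max(1)[OF p(1)]]) auto
  then have "variation_up_to g t - variation_up_to g s < polygon_length g n (\<lambda>k. max (p k) s) + \<eta>"
    using polygon_length_split[OF p(1), of g n s] p(3) by linarith
  moreover have "max (p k) s \<in> {s..t}" for k using p(2)[of k] \<open>s \<le> t\<close> by auto
  ultimately show thesis using that mono_min_max(2)[OF p(1)] by blast
qed

text \<open>Each interval of the division is refined by a polygon that nearly realizes its increment
  of variation. All sides together are again nonoverlapping and not longer in total, so a
  \<open>\<delta>\<close> that works for \<open>g\<close> works for its variation.\<close>

lemma uniformly_abs_cont_variation:
  fixes g :: "real \<Rightarrow> 'x::metric_space"
  assumes g: "uniformly_abs_cont g" and B: "\<And>n p. mono p \<Longrightarrow> polygon_length g n p \<le> B"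
  shows "uniformly_abs_cont (variation_up_to g)"
  unfolding uniformly_abs_cont_def
proof (intro allI impI)
  let ?V = "variation_up_to g"
  fix \<epsilon> :: real assume "\<epsilon> > 0"
  then obtain \<delta> where "\<delta> > 0" and \<delta>: "\<And>D S. D division_of S \<Longrightarrow> S \<subseteq> UNIV \<Longrightarrow> (\<Sum>k\<in>D. Sup k - Inf k) < \<delta> \<Longrightarrow>
       (\<Sum>k\<in>D. dist (g (Inf k)) (g (Sup k))) < \<epsilon> / 2"
    using uniformly_abs_contD[OF g, of "\<epsilon> / 2"] by auto
  have "(\<Sum>k\<in>D. dist (?V (Inf k)) (?V (Sup k))) < \<epsilon>"
    if "D division_of S" "(\<Sum>k\<in>D. Sup k - Inf k) < \<delta>" for D S
  proof -
    note div = division_real[OF that(1)]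
    have "finite D" using that by auto
    \<comment> \<open>The extra 1 keeps \<open>N\<close> positive for the empty division; the errors
      \<open>\<eta>\<close> add up to at most \<open>\<epsilon> / 2\<close>.\<close>
    define N where "N = real (card D) + 1"
    define \<eta> where "\<eta> = \<epsilon> / 2 / N"
    have "N > 0" by (simp add: N_def)
    have "\<eta> > 0" using \<open>\<epsilon> > 0\<close> \<open>N > 0\<close> by (simp add: \<eta>_def)
    have "\<forall>k\<in>D. \<exists>n p. mono p \<and> (\<forall>i. p i \<in> {Inf k..Sup k}) \<and>
        ?V (Sup k) - ?V (Inf k) < polygon_length g n p + \<eta>"
      using variation_diff_approx[OF B, of _ _ \<eta>] div(2) \<open>\<eta> > 0\<close> by metis
    then obtain n p where p: "\<And>k. k \<in> D \<Longrightarrow> mono (p k)" "\<And>k i. k \<in> D \<Longrightarrow> p k i \<in> {Inf k..Sup k}"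
      "\<And>k. k \<in> D \<Longrightarrow> ?V (Sup k) - ?V (Inf k) < polygon_length g (n k) (p k) + \<eta>"
      by metis
    let ?I = "Sigma D (\<lambda>k. {..<n k})"
    have "(\<Sum>(k,i)\<in>?I. dist (g (p k i)) (g (p k (Suc i)))) < \<epsilon> / 2"
      unfolding split_def
    proof (rule sum_dist_family_less[OF \<delta>])
      show "finite ?I" using \<open>finite D\<close> by auto
      show "p (fst x) (snd x) \<le> p (fst x) (Suc (snd x))" if "x \<in> ?I" for x
        using that p(1) by (auto simp: mono_def)
      have "(\<Sum>x\<in>?I. p (fst x) (Suc (snd x)) - p (fst x) (snd x)) = (\<Sum>k\<in>D. \<Sum>i<n k. p k (Suc i) - p k i)"
        using \<open>finite D\<close> by (subst sum.Sigma) (auto simp: split_def)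
      also have "\<dots> = (\<Sum>k\<in>D. p k (n k) - p k 0)" by (simp add: sum_lessThan_telescope)
      also have "\<dots> \<le> (\<Sum>k\<in>D. Sup k - Inf k)"
        using p(2) by (intro sum_mono) (meson atLeastAtMost_iff diff_mono)
      finally show "(\<Sum>x\<in>?I. p (fst x) (Suc (snd x)) - p (fst x) (snd x)) < \<delta>" using that by linarith
      fix x y assume xy: "x \<in> ?I" "y \<in> ?I" "x \<noteq> y"
      show "{p (fst x) (snd x)<..<p (fst x) (Suc (snd x))} \<inter> {p (fst y) (snd y)<..<p (fst y) (Suc (snd y))} = {}"
      proof (cases "fst x = fst y")
        case True
        then have "snd x \<noteq> snd y" using xy by (simp add: prod_eq_iff)
        then show ?thesis using True polygon_disjoint[OF p(1)] xy by auto
      next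
        case False
        have D: "fst x \<in> D" "fst y \<in> D" using xy by auto
        then have "interior (fst x) \<inter> interior (fst y) = {}"
          using division_ofD(5)[OF that(1)] False by blast
        moreover have "{p k i<..<p k (Suc i)} \<subseteq> interior k" if "k \<in> D" for k i
        proof -
          have "{p k i<..<p k (Suc i)} \<subseteq> interior {Inf k..Sup k}"
            using p(2)[OF that, of i] p(2)[OF that, of "Suc i"] by auto
          then show ?thesis using div(1)[OF that] by argo
        qed
        ultimately show ?thesis using D by blast
      qed
    qed auto
    then have "(\<Sum>k\<in>D. polygon_length g (n k) (p k)) < \<epsilon> / 2"
      using \<open>finite D\<close> by (simp add: polygon_length_def sum.Sigma)
    moreover have "(\<Sum>k\<in>D. dist (?V (Inf k)) (?V (Sup k))) \<le> (\<Sum>k\<in>D. polygon_length g (n k) (p k) + \<eta>)"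
    proof (rule sum_mono)
      fix k assume "k \<in> D"
      then have "?V (Inf k) \<le> ?V (Sup k)"
        using dist_le_variation_diff[OF B div(2)[OF \<open>k \<in> D\<close>]] zero_le_dist[of "g (Inf k)" "g (Sup k)"]
        by linarith
      then show "dist (?V (Inf k)) (?V (Sup k)) \<le> polygon_length g (n k) (p k) + \<eta>"
        using p(3)[OF \<open>k \<in> D\<close>] by (simp add: dist_real_def)
    qed
    moreover have "card D * \<eta> \<le> N * \<eta>" using \<open>\<eta> > 0\<close> by (simp add: N_def)
    moreover have "N * \<eta> = \<epsilon> / 2" using \<open>N > 0\<close> by (simp add: \<eta>_def)
    ultimately show ?thesis by (simp add: sum.distrib)
  qed
  with \<open>\<delta> > 0\<close> show "\<exists>\<delta>>0. \<forall>D S. D division_of S \<and> (\<Sum>k\<in>D. Sup k - Inf k) < \<delta> \<longrightarrow>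
       (\<Sum>k\<in>D. dist (?V (Inf k)) (?V (Sup k))) < \<epsilon>" by blast
qed

lemma uniformly_abs_cont_imp_continuous:
  fixes g :: "real \<Rightarrow> 'x::metric_space"
  assumes "uniformly_abs_cont g"
  shows "continuous_on UNIV g"
  unfolding continuous_on_iff
proof (intro ballI allI impI)
  fix x \<epsilon> :: real assume "\<epsilon> > 0"
  then obtain \<delta> where "\<delta> > 0" and \<delta>: "\<And>D S. D division_of S \<Longrightarrow> S \<subseteq> UNIV \<Longrightarrow> (\<Sum>k\<in>D. Sup k - Inf k) < \<delta> \<Longrightarrow>
       (\<Sum>k\<in>D. dist (g (Inf k)) (g (Sup k))) < \<epsilon>"
    using uniformly_abs_contD[OF assms] by blast
  have *: "dist (g u) (g v) < \<epsilon>" if "u \<le> v" "v - u < \<delta>" for u v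
    using \<delta>[OF division_of_self[of u v]] that by simp
  have "dist (g x') (g x) < \<epsilon>" if "dist x' x < \<delta>" for x'
    using *[of x x'] *[of x' x] that by (cases "x \<le> x'") (auto simp: dist_real_def dist_commute)
  with \<open>\<delta> > 0\<close> show "\<exists>d>0. \<forall>x'\<in>UNIV. dist x' x < d \<longrightarrow> dist (g x') (g x) < \<epsilon>" by blast
qed

section \<open>From absolute continuity to a density\<close>

text \<open>Absolute continuity speaks of finite families of intervals, whereas outer regularity
  provides open sets; this exhaustion connects the two.\<close>

lemma open_real_eq_UN_incseq_division:
  fixes U :: "real set"
  assumes "open U"
  obtains A where "incseq A" "U = (\<Union>n. A n)" "\<And>n::nat. \<exists>D. D division_of A n"
proof
  define K :: "nat \<Rightarrow> real set" where "K n = (let (r, s) = from_nat n :: rat \<times> rat in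
    if {of_rat r..of_rat s} \<subseteq> U then {of_rat r..of_rat s} else {})" for n
  let ?A = "\<lambda>n::nat. \<Union>i\<le>n. K i"
  show "incseq ?A" by (auto simp: incseq_def) (meson atMost_iff order_trans)
  have "K n \<subseteq> U" for n by (simp add: K_def split: prod.split)
  moreover have "x \<in> (\<Union>n. K n)" if xU: "x \<in> U" for x
  proof -
    obtain e where e: "e > 0" "ball x e \<subseteq> U" using openE[OF \<open>open U\<close> xU] by blast
    obtain r where r: "x - e < of_rat r" "of_rat r < x" using of_rat_dense[of "x - e" x] e by auto
    obtain s where s: "x < of_rat s" "of_rat s < x + e" using of_rat_dense[of x "x + e"] e by auto
    have "{of_rat r..of_rat s} \<subseteq> ball x e" using r s by (auto simp: dist_real_def)
    then have "x \<in> K (to_nat (r, s))" using e r s by (auto simp: K_def)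
    then show ?thesis by blast
  qed
  ultimately have "U = (\<Union>n. K n)" by (intro equalityI subsetI) (blast, blast)
  then show "U = (\<Union>n. ?A n)" by (auto intro: order_refl)
  show "\<exists>D. D division_of ?A n" for n
  proof -
    have "\<exists>a b. K i = cbox a b" for i
    proof (cases "K i = {}")
      case True
      then have "K i = cbox 1 0" by simp
      then show ?thesis by blast
    qed (auto simp: K_def split: prod.splits if_splits)
    then have "\<exists>a b. s = cbox a b" if "s \<in> K ` {..n}" for s
      using that by blast
    then obtain D where "D division_of \<Union>(K ` {..n})"
      by (rule elementary_unions_intervals[OF finite_imageI[OF finite_atMost]])
    then show ?thesis by auto
  qed
qed

lemma division_real_borel:
  assumes D: "D division_of (S::real set)"
  shows "finite D" "k \<in> D \<Longrightarrow> k \<in> sets borel" "S \<in> sets borel"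
proof -
  show fin: "finite D" using D by auto
  have "cbox a b \<in> sets borel" for a b :: real by simp
  then have borel: "k \<in> sets borel" if "k \<in> D" for k
    using division_ofD(4)[OF D that] by blast
  then show "k \<in> D \<Longrightarrow> k \<in> sets borel" .
  show "S \<in> sets borel"
    unfolding division_ofD(6)[OF D, symmetric] by (rule sets.finite_Union[OF fin]) (use borel in blast)
qed

text \<open>Outer regularity encloses a null set in an open set of length below
  \<open>\<delta>\<close>. The divisions exhausting the open set have total
  \<open>F\<close>-increment below \<open>\<epsilon>\<close>, and continuity from below passes this
  bound to the open set.\<close>

lemma absolutely_continuous_interval_measure:
  fixes F :: "real \<Rightarrow> real"
  assumes F: "uniformly_abs_cont F" "mono F"
  shows "absolutely_continuous lborel (interval_measure F)"
  unfolding absolutely_continuous_def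
proof
  let ?M = "interval_measure F"
  have Icc: "emeasure ?M {a..b} = ennreal (F b - F a)" if "a \<le> b" for a b
    using emeasure_interval_measure_Icc[OF that] \<open>mono F\<close> uniformly_abs_cont_imp_continuous[OF F(1)]
    by (simp add: mono_def)
  fix N :: "real set" assume N: "N \<in> null_sets lborel"
  have small: "emeasure ?M N \<le> ennreal \<epsilon>" if eps: "\<epsilon> > 0" for \<epsilon> :: real
  proof -
    obtain \<delta> where "\<delta> > 0" and \<delta>: "\<And>D S. D division_of S \<Longrightarrow> S \<subseteq> UNIV \<Longrightarrow> (\<Sum>k\<in>D. Sup k - Inf k) < \<delta> \<Longrightarrow>
         (\<Sum>k\<in>D. dist (F (Inf k)) (F (Sup k))) < \<epsilon>"
      using uniformly_abs_contD[OF F(1) eps] by blast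
    have "N \<in> sets borel" using N by auto
    then obtain U where U: "open U" "N \<subseteq> U" "emeasure lborel (U - N) < \<delta>"
      using outer_regular_lborel \<open>\<delta> > 0\<close> by blast
    have "emeasure lborel U = emeasure lborel (U - N)"
      using U N emeasure_Diff_null_set[of N lborel U] by auto
    then have U_small: "emeasure lborel U < \<delta>" using U by simp
    obtain A where A: "incseq A" "U = (\<Union>n. A n)" "\<And>n::nat. \<exists>D. D division_of A n"
      using open_real_eq_UN_incseq_division[OF U(1)] by blast
    have "emeasure ?M (A n) \<le> \<epsilon>" for n
    proof -
      obtain D where D: "D division_of A n" using A by blast
      note div = division_real[OF D]
      note fin = division_real_borel[OF D]
      have "(\<Sum>k\<in>D. Sup k - Inf k) = (\<Sum>k\<in>D. measure lebesgue k)"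
      proof (rule sum.cong)
        fix k assume "k \<in> D"
        then obtain a b where "k = {a..b}" "a \<le> b" using div by blast
        then show "Sup k - Inf k = measure lebesgue k" by simp
      qed simp
      also have "\<dots> = measure lborel (A n)" using content_division[OF D] fin(3) by simp
      also have "\<dots> < \<delta>"
      proof -
        have "emeasure lborel (A n) \<le> emeasure lborel U"
          using A(2) U(1) by (intro emeasure_mono) auto
        then have "emeasure lborel (A n) < \<delta>" using U_small by simp
        moreover from this have "emeasure lborel (A n) = ennreal (measure lborel (A n))"
            by (intro emeasure_eq_ennreal_measure) auto
          ultimately show ?thesis by (simp add: ennreal_less_iff)
      qed
      finally have "(\<Sum>k\<in>D. dist (F (Inf k)) (F (Sup k))) < \<epsilon>" using \<delta>[OF D] by simp
      moreover have "emeasure ?M (A n) \<le> (\<Sum>k\<in>D. emeasure ?M k)"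
        using emeasure_subadditive_finite[of D "\<lambda>k. k" ?M] fin division_ofD(6)[OF D] by auto
      moreover have "(\<Sum>k\<in>D. emeasure ?M k) = (\<Sum>k\<in>D. ennreal (dist (F (Inf k)) (F (Sup k))))"
      proof (rule sum.cong)
        fix k assume "k \<in> D"
        then obtain a b where "k = {a..b}" "a \<le> b" using div by blast
        then show "emeasure ?M k = ennreal (dist (F (Inf k)) (F (Sup k)))"
          using Icc[of a b] \<open>mono F\<close> by (simp add: dist_real_def mono_def)
      qed simp
      ultimately have "emeasure ?M (A n) \<le> ennreal (\<Sum>k\<in>D. dist (F (Inf k)) (F (Sup k)))" by simp
      also have "\<dots> \<le> \<epsilon>"
        using \<open>(\<Sum>k\<in>D. dist (F (Inf k)) (F (Sup k))) < \<epsilon>\<close> by (intro ennreal_leI) simp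
      finally show ?thesis .
    qed
    moreover have "range A \<subseteq> sets ?M"
    proof safe
      fix n
      obtain D where "D division_of A n" using A by blast
      then show "A n \<in> sets ?M" using division_real_borel(3) by simp
    qed
    ultimately have "emeasure ?M U \<le> \<epsilon>"
      unfolding A(2) by (subst SUP_emeasure_incseq[symmetric]) (use A in \<open>auto intro: SUP_least\<close>)
    moreover have "emeasure ?M N \<le> emeasure ?M U" using U by (intro emeasure_mono) auto
    ultimately show ?thesis by simp
  qed
  have "emeasure ?M N \<le> 0"
  proof (rule ennreal_le_epsilon)
    show "emeasure ?M N \<le> 0 + ennreal e" if "0 < e" for e using small[OF that] by simp
  qed
  moreover have "N \<in> sets ?M" using N by (simp add: null_sets_def)
  ultimately show "N \<in> null_sets ?M" by (simp add: null_sets_def)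
qed

text \<open>The density is the Radon-Nikodym derivative of the Stieltjes measure of
  \<open>F\<close>; it is finite almost everywhere, so \<open>enn2real\<close> does not affect
  integrals.\<close>

lemma uniformly_abs_cont_mono_density:
  fixes F :: "real \<Rightarrow> real"
  assumes F: "uniformly_abs_cont F" "mono F"
  obtains w where "w \<in> borel_measurable borel" "\<And>x. 0 \<le> w x"
    "\<And>s t. s \<le> t \<Longrightarrow> (w has_integral (F t - F s)) {s..t}"
proof -
  let ?M = "interval_measure F"
  let ?f = "RN_deriv lborel ?M"
  have cont: "continuous_on UNIV F" by (rule uniformly_abs_cont_imp_continuous[OF F(1)])
  have mono: "F x \<le> F y" if "x \<le> y" for x y using that F(2) by (simp add: mono_def)
  have ac: "absolutely_continuous lborel ?M" by (rule absolutely_continuous_interval_measure[OF F])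
  have sf: "sigma_finite_measure ?M"
    by (rule sigma_finite_interval_measure[OF mono])
      (use cont in \<open>auto intro: continuous_within_subset simp: continuous_on_eq_continuous_within\<close>)
  have dens: "density lborel ?f = ?M" by (rule sigma_finite_measure.density_RN_deriv[OF sigma_finite_lborel ac]) simp
  have fin: "AE x in lborel. ?f x \<noteq> \<infinity>" by (rule sigma_finite_measure.RN_deriv_finite[OF sigma_finite_lborel sf ac]) simp
  have [measurable]: "?f \<in> borel_measurable borel" using borel_measurable_RN_deriv[of lborel ?M] by simp
  let ?w = "\<lambda>x. enn2real (?f x)"
  show thesis
  proof
    show "?w \<in> borel_measurable borel" by simp
    fix s t :: real assume "s \<le> t"
    have "(\<integral>\<^sup>+x. ennreal (if x \<in> {s..t} then ?w x else 0) \<partial>lborel) = (\<integral>\<^sup>+x. ?f x * indicator {s..t} x \<partial>lborel)"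
      by (rule nn_integral_cong_AE, use fin in eventually_elim) (auto simp: less_top)
    also have "\<dots> = emeasure ?M {s..t}"
      by (subst dens[symmetric], subst emeasure_density) auto
    also have "\<dots> = ennreal (F t - F s)" using emeasure_interval_measure_Icc[OF \<open>s \<le> t\<close> mono cont] by simp
    finally have "((\<lambda>x. if x \<in> {s..t} then ?w x else 0) has_integral (F t - F s)) UNIV"
      by (intro nn_integral_has_integral) (use mono \<open>s \<le> t\<close> in auto)
    then show "(?w has_integral (F t - F s)) {s..t}" by (simp only: has_integral_restrict_UNIV)
  qed simp
qed

section \<open>Differentiation of absolutely continuous curves\<close>

text \<open>The second condition says that the metric derivative of \<open>c\<close> at \<open>0\<close> is the supremum of the
  absolute derivatives of its distances to the \<open>y i\<close>.\<close>

definition dist_regular :: "(nat \<Rightarrow> 'x::metric_space) \<Rightarrow> (real \<Rightarrow> 'x) \<Rightarrow> bool"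
  where "dist_regular y c \<longleftrightarrow>
    (\<forall>i. \<exists>D. ((\<lambda>h. (dist (c h) (y i) - dist (c 0) (y i)) / h) \<longlongrightarrow> D) (at 0)) \<and>
    (\<forall>e>0. \<exists>i. \<exists>d>0. \<forall>h. \<bar>h\<bar> < d \<longrightarrow>
       dist (c h) (c 0) \<le> \<bar>dist (c h) (y i) - dist (c 0) (y i)\<bar> + e * \<bar>h\<bar>)"

lemma has_real_derivative_approx:
  fixes G :: "real \<Rightarrow> real"
  assumes "(G has_real_derivative D) (at t)" "e > 0"
  obtains d where "d > 0" "\<And>h. \<bar>h\<bar> < d \<Longrightarrow> \<bar>G (t + h) - G t\<bar> \<le> (\<bar>D\<bar> + e) * \<bar>h\<bar>"
    "\<And>h. \<bar>h\<bar> < d \<Longrightarrow> (\<bar>D\<bar> - e) * \<bar>h\<bar> \<le> \<bar>G (t + h) - G t\<bar>"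
proof -
  have "((\<lambda>h. (G (t + h) - G t) / h) \<longlongrightarrow> D) (at 0)"
    using assms(1) by (simp add: DERIV_def)
  then obtain d where d: "d > 0" "\<And>h. h \<noteq> 0 \<Longrightarrow> \<bar>h\<bar> < d \<Longrightarrow> \<bar>(G (t + h) - G t) / h - D\<bar> < e"
    using assms(2) unfolding tendsto_iff eventually_at by (auto simp: dist_real_def)
  have "\<bar>G (t + h) - G t\<bar> \<le> (\<bar>D\<bar> + e) * \<bar>h\<bar> \<and> (\<bar>D\<bar> - e) * \<bar>h\<bar> \<le> \<bar>G (t + h) - G t\<bar>"
    if "\<bar>h\<bar> < d" for h
  proof (cases "h = 0")
    case False
    define Q where "Q = (G (t + h) - G t) / h"
    have "\<bar>G (t + h) - G t\<bar> = \<bar>Q\<bar> * \<bar>h\<bar>"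
      using False by (subst abs_mult[symmetric]) (simp add: Q_def)
    moreover have "\<bar>Q\<bar> \<le> \<bar>D\<bar> + e" "\<bar>D\<bar> - e \<le> \<bar>Q\<bar>" using d(2)[OF False that] by (auto simp: Q_def[symmetric])
    ultimately show ?thesis by (simp add: mult_right_mono)
  qed simp
  with d(1) show thesis using that by blast
qed

lemma primitive_exists:
  fixes m :: "real \<Rightarrow> real"
  assumes m: "\<And>s t. m integrable_on {s..t}"
  obtains F where "\<And>s t. s \<le> t \<Longrightarrow> (m has_integral (F t - F s)) {s..t}"
proof
  \<comment> \<open>The signed integral from 0: for either sign of \<open>t\<close> one of the two
    intervals is empty or a point and contributes nothing.\<close>
  define F where "F t = integral {0..t} m - integral {t..0} m" for t
  fix s t :: real assume "s \<le> t"
  have comb: "integral {a..c} m + integral {c..b} m = integral {a..b} m" if "a \<le> c" "c \<le> b" for a b c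
    using Henstock_Kurzweil_Integration.integral_combine[OF that m] .
  have zero: "integral {a..b} m = 0" if "b \<le> a" for a b
    using that by (cases "a = b") auto
  have "integral {s..t} m = F t - F s"
  proof -
    consider "0 \<le> s" | "t \<le> 0" | "s \<le> 0" "0 \<le> t" by linarith
    then show ?thesis
      using comb[of 0 s t] comb[of s t 0] comb[of s 0 t] \<open>s \<le> t\<close> by cases (auto simp: F_def zero)
  qed
  then show "(m has_integral (F t - F s)) {s..t}" using integrable_integral[OF m] by metis
qed

text \<open>Meant for a distance function and the variation, whose densities are thus compared
  pointwise. A comparison to the right of \<open>t\<close> is enough because both derivatives are
  two-sided.\<close>

lemma deriv_abs_le:
  fixes G V :: "real \<Rightarrow> real"
  assumes G: "(G has_real_derivative u) (at t)" and V: "(V has_real_derivative w) (at t)"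
    and le: "\<And>s. t \<le> s \<Longrightarrow> \<bar>G s - G t\<bar> \<le> V s - V t"
  shows "\<bar>u\<bar> \<le> \<bar>w\<bar>"
proof (rule field_le_epsilon)
  fix e :: real assume "e > 0"
  then have "e / 2 > 0" by simp
  obtain d where d: "d > 0" "\<And>h. \<bar>h\<bar> < d \<Longrightarrow> (\<bar>u\<bar> - e / 2) * \<bar>h\<bar> \<le> \<bar>G (t + h) - G t\<bar>"
    by (rule has_real_derivative_approx[OF G \<open>e / 2 > 0\<close>]) (rule that)
  obtain d' where d': "d' > 0" "\<And>h. \<bar>h\<bar> < d' \<Longrightarrow> \<bar>V (t + h) - V t\<bar> \<le> (\<bar>w\<bar> + e / 2) * \<bar>h\<bar>"
    by (rule has_real_derivative_approx[OF V \<open>e / 2 > 0\<close>]) (rule that)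
  define h where "h = min d d' / 2"
  have h: "h > 0" "\<bar>h\<bar> < d" "\<bar>h\<bar> < d'" using d(1) d'(1) by (auto simp: h_def min_def)
  have "(\<bar>u\<bar> - e / 2) * \<bar>h\<bar> \<le> (\<bar>w\<bar> + e / 2) * \<bar>h\<bar>"
    using d(2)[OF h(2)] d'(2)[OF h(3)] le[of "t + h"] h(1) by linarith
  then have "\<bar>u\<bar> - e / 2 \<le> \<bar>w\<bar> + e / 2" by (rule mult_right_le_imp_le) (use h(1) in simp)
  then show "\<bar>u\<bar> \<le> \<bar>w\<bar> + e" by simp
qed

lemma uniformly_abs_cont_dominated:
  fixes F V :: "real \<Rightarrow> real"
  assumes V: "uniformly_abs_cont V" and le: "\<And>s t. s \<le> t \<Longrightarrow> \<bar>F t - F s\<bar> \<le> K * (V t - V s)" and "K > 0"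
  shows "uniformly_abs_cont F"
  unfolding uniformly_abs_cont_def
proof (intro allI impI)
  fix \<epsilon> :: real assume "\<epsilon> > 0"
  then have "\<epsilon> / K > 0" using \<open>K > 0\<close> by simp
  obtain \<delta> where "\<delta> > 0" and \<delta>: "\<And>D S. D division_of S \<Longrightarrow> S \<subseteq> UNIV \<Longrightarrow> (\<Sum>k\<in>D. Sup k - Inf k) < \<delta> \<Longrightarrow>
       (\<Sum>k\<in>D. dist (V (Inf k)) (V (Sup k))) < \<epsilon> / K"
    by (rule uniformly_abs_contD[OF V \<open>\<epsilon> / K > 0\<close>]) (rule that)
  have "(\<Sum>k\<in>D. dist (F (Inf k)) (F (Sup k))) < \<epsilon>"
    if D: "D division_of S" "(\<Sum>k\<in>D. Sup k - Inf k) < \<delta>" for D S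
  proof -
    have "(\<Sum>k\<in>D. dist (F (Inf k)) (F (Sup k))) \<le> (\<Sum>k\<in>D. K * dist (V (Inf k)) (V (Sup k)))"
    proof (rule sum_mono)
      fix k assume "k \<in> D"
      have "\<bar>F (Sup k) - F (Inf k)\<bar> \<le> K * (V (Sup k) - V (Inf k))"
        by (rule le[OF division_real(2)[OF D(1) \<open>k \<in> D\<close>]])
      also have "\<dots> \<le> K * \<bar>V (Sup k) - V (Inf k)\<bar>" using \<open>K > 0\<close> by simp
      finally show "dist (F (Inf k)) (F (Sup k)) \<le> K * dist (V (Inf k)) (V (Sup k))"
        by (simp add: dist_real_def abs_minus_commute)
    qed
    also have "\<dots> = K * (\<Sum>k\<in>D. dist (V (Inf k)) (V (Sup k)))" by (rule sum_distrib_left[symmetric])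
    also have "\<dots> < \<epsilon>" using \<delta>[OF D(1) _ D(2)] \<open>K > 0\<close> by (simp add: pos_less_divide_eq mult.commute)
    finally show ?thesis .
  qed
  with \<open>\<delta> > 0\<close> show "\<exists>\<delta>>0. \<forall>D S. D division_of S \<and> (\<Sum>k\<in>D. Sup k - Inf k) < \<delta> \<longrightarrow>
       (\<Sum>k\<in>D. dist (F (Inf k)) (F (Sup k))) < \<epsilon>" by blast
qed

text \<open>The metric derivative is the density \<open>m\<close> below, the supremum of the absolute derivatives of the
  distance functions; the variation only serves to see that \<open>m\<close> is integrable.\<close>

lemma negligible_not_dist_regular:
  fixes \<gamma> :: "real \<Rightarrow> 'x::metric_space" and y :: "nat \<Rightarrow> 'x"
  assumes \<gamma>: "uniformly_abs_cont \<gamma>" "\<And>u. u \<le> a \<Longrightarrow> \<gamma> u = \<gamma> a" "\<And>u. b \<le> u \<Longrightarrow> \<gamma> u = \<gamma> b"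
    and sep: "\<And>t. \<gamma> t \<in> closure (range y)"
  shows "negligible {t. \<not> dist_regular y (\<lambda>h. \<gamma> (t + h))}"
proof -
  obtain B where B: "\<And>n p. mono p \<Longrightarrow> polygon_length \<gamma> n p \<le> B"
    using bounded_polygon_length[of \<gamma> a b] \<gamma> by blast
  define V where "V = variation_up_to \<gamma>"
  have V: "uniformly_abs_cont V" unfolding V_def by (rule uniformly_abs_cont_variation[OF \<gamma>(1) B])
  have dV: "dist (\<gamma> s) (\<gamma> t) \<le> V t - V s" if "s \<le> t" for s t
    using dist_le_variation_diff[OF B that] by (simp add: V_def)
  have "mono V"
  proof (rule monoI)
    fix s t :: real assume "s \<le> t"
    then show "V s \<le> V t" using dV[of s t] zero_le_dist[of "\<gamma> s" "\<gamma> t"] by linarith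
  qed
  obtain w where w: "w \<in> borel_measurable borel" "\<And>x. 0 \<le> w x"
    "\<And>s t. s \<le> t \<Longrightarrow> (w has_integral (V t - V s)) {s..t}"
    by (rule uniformly_abs_cont_mono_density[OF V \<open>mono V\<close>]) (rule that)
  define g where "g i t = dist (\<gamma> t) (y i)" for i t
  have gV: "\<bar>g i t - g i s\<bar> \<le> V t - V s" if "s \<le> t" for i s t
    using dV[OF that] abs_dist_diff_le[of "\<gamma> t" "y i" "\<gamma> s"] by (simp add: g_def dist_commute)
  have "\<exists>u. u \<in> borel_measurable borel \<and> (\<forall>s t. s \<le> t \<longrightarrow> (u has_integral (g i t - g i s)) {s..t})" for i
  proof -
    have *: "\<bar>g i t + V t - (g i s + V s)\<bar> \<le> 2 * (V t - V s)" "g i s + V s \<le> g i t + V t"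
      if "s \<le> t" for s t using gV[OF that, of i] by auto
    \<comment> \<open>A distance function is not monotone, but adding \<open>V\<close>, which
      dominates its increments, makes it so. Subtracting the density of \<open>V\<close> afterwards
      leaves a signed density for \<open>g i\<close>.\<close>
    have "uniformly_abs_cont (\<lambda>t. g i t + V t)"
      by (rule uniformly_abs_cont_dominated[OF V *(1)]) auto
    moreover have "mono (\<lambda>t. g i t + V t)" using *(2) by (rule monoI)
    ultimately obtain v where v: "v \<in> borel_measurable borel"
      "\<And>s t. s \<le> t \<Longrightarrow> (v has_integral (g i t + V t - (g i s + V s))) {s..t}"
      by (rule uniformly_abs_cont_mono_density) (rule that)
    show ?thesis
    proof (intro exI[of _ "\<lambda>t. v t - w t"] conjI allI impI)
      show "(\<lambda>t. v t - w t) \<in> borel_measurable borel" using v(1) w(1) by simp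
      fix s t :: real assume "s \<le> t"
      show "((\<lambda>t. v t - w t) has_integral (g i t - g i s)) {s..t}"
        using has_integral_diff[OF v(2)[OF \<open>s \<le> t\<close>] w(3)[OF \<open>s \<le> t\<close>]] by simp
    qed
  qed
  then obtain u where u: "\<And>i. u i \<in> borel_measurable borel"
    "\<And>i s t. s \<le> t \<Longrightarrow> (u i has_integral (g i t - g i s)) {s..t}" by metis
  define N where "N = {t. \<not> (V has_real_derivative w t) (at t)} \<union>
    (\<Union>i. {t. \<not> (g i has_real_derivative u i t) (at t)})"
  have N: "negligible N" unfolding N_def
    by (intro negligible_Un negligible_Union_nat Lebesgue_differentiation_real) (auto intro: w u)
  have uw: "\<bar>u i t\<bar> \<le> w t" if "t \<notin> N" for i t
  proof -
    have "\<bar>u i t\<bar> \<le> \<bar>w t\<bar>"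
      by (rule deriv_abs_le[of "g i" _ t V]) (use that gV in \<open>auto simp: N_def\<close>)
    then show ?thesis using w(2)[of t] by simp
  qed
  \<comment> \<open>The bound by \<open>w\<close> is known only off \<open>N\<close>. Truncation
    enforces it everywhere, so that the supremum below is finite at every point; off
    \<open>N\<close>, and hence in every integral, nothing changes.\<close>
  define c where "c i t = max (- w t) (min (w t) (u i t))" for i t
  have c: "\<bar>c i t\<bar> \<le> w t" for i t using w(2)[of t] by (auto simp: c_def)
  have cu: "c i t = u i t" if "t \<notin> N" for i t using uw[OF that, of i] by (auto simp: c_def)
  have c_int: "(c i has_integral (g i t - g i s)) {s..t}" if "s \<le> t" for i s t
    by (rule has_integral_spike[OF N _ u(2)[OF that]]) (use cu in auto)
  have [measurable]: "w \<in> borel_measurable borel" "u i \<in> borel_measurable borel" for i using w u by auto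
  define m where "m t = (SUP i. \<bar>c i t\<bar>)" for t
  have bdd: "bdd_above (range (\<lambda>i. \<bar>c i t\<bar>))" for t by (rule bdd_aboveI[of _ "w t"]) (use c in auto)
  have cm: "\<bar>c i t\<bar> \<le> m t" for i t unfolding m_def by (rule cSUP_upper[OF _ bdd]) simp
  have mw: "m t \<le> w t" for t unfolding m_def by (rule cSUP_least) (use c in auto)
  have m0: "0 \<le> m t" for t using cm[of 0 t] by linarith
  have m_meas: "m \<in> borel_measurable borel"
    unfolding m_def c_def by (rule borel_measurable_cSUP) (use bdd in \<open>auto simp: c_def\<close>)
  have m_int: "m integrable_on {s..t}" for s t
  proof (cases "s \<le> t")
    case True
    show ?thesis
    proof (rule measurable_bounded_by_integrable_imp_integrable)
      show "m \<in> borel_measurable (lebesgue_on {s..t})"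
        using m_meas by (intro measurable_restrict_space1 measurable_completion) simp
      show "w integrable_on {s..t}" using w(3)[OF True] by blast
    qed (use m0 mw in auto)
  qed (simp add: integrable_on_empty)
  \<comment> \<open>Unlike \<open>V\<close>, which was only seen to dominate, \<open>F\<close> has
    derivative \<open>m t\<close> at almost every \<open>t\<close>, and by the next two facts it
    still bounds the increments of the curve.\<close>
  obtain F where F: "\<And>s t. s \<le> t \<Longrightarrow> (m has_integral (F t - F s)) {s..t}"
    by (rule primitive_exists[OF m_int]) (rule that)
  have gF: "\<bar>g i t - g i s\<bar> \<le> F t - F s" if "s \<le> t" for i s t
  proof -
    have "norm (integral {s..t} (c i)) \<le> integral {s..t} m"
      by (rule integral_norm_bound_integral) (use c_int[OF that] m_int cm in auto)
    then show ?thesis using integral_unique[OF c_int[OF that]] integral_unique[OF F[OF that]] by simp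
  qed
  \<comment> \<open>The distance exceeds the increment of \<open>g i\<close> by at most
    \<open>2 * g i s\<close>, which is below \<open>e\<close> once \<open>y i\<close> lies within
    \<open>e / 2\<close> of \<open>\<gamma> s\<close>.\<close>
  have dF: "dist (\<gamma> t) (\<gamma> s) \<le> F t - F s" if "s \<le> t" for s t
  proof (rule field_le_epsilon)
    fix e :: real assume "e > 0"
    then obtain i where i: "dist (y i) (\<gamma> s) < e / 2"
      using sep[of s] unfolding closure_approachable by (metis half_gt_zero rangeE)
    have "dist (\<gamma> t) (\<gamma> s) \<le> g i t + g i s" unfolding g_def by (rule dist_triangle2)
    also have "\<dots> \<le> F t - F s + e" using gF[OF that, of i] i by (simp add: g_def dist_commute abs_le_iff)
    finally show "dist (\<gamma> t) (\<gamma> s) \<le> F t - F s + e" .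
  qed
  have "dist_regular y (\<lambda>h. \<gamma> (t + h))" if "t \<notin> N" and Fm: "(F has_real_derivative m t) (at t)" for t
    unfolding dist_regular_def
  proof (intro conjI allI impI)
    have gd: "(g i has_real_derivative u i t) (at t)" for i using \<open>t \<notin> N\<close> by (auto simp: N_def)
    then show "\<exists>D. ((\<lambda>h. (dist (\<gamma> (t + h)) (y i) - dist (\<gamma> (t + 0)) (y i)) / h) \<longlongrightarrow> D) (at 0)" for i
      unfolding DERIV_def g_def by auto
    fix e :: real assume "e > 0"
    \<comment> \<open>One third of \<open>e\<close> each for the choice of \<open>i\<close> in the
      supremum, for the derivative of \<open>g i\<close> and for that of \<open>F\<close>.\<close>
    have "m t - e / 3 < (SUP i. \<bar>c i t\<bar>)" using \<open>e > 0\<close> by (simp add: m_def[symmetric])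
    then obtain i where "m t - e / 3 < \<bar>c i t\<bar>" using less_cSUP_iff[OF _ bdd] by blast
    then have i: "m t - e / 3 < \<bar>u i t\<bar>" using cu[OF \<open>t \<notin> N\<close>] by simp
    have "e / 3 > 0" using \<open>e > 0\<close> by simp
    obtain d where d: "d > 0" "\<And>h. \<bar>h\<bar> < d \<Longrightarrow> (\<bar>u i t\<bar> - e / 3) * \<bar>h\<bar> \<le> \<bar>g i (t + h) - g i t\<bar>"
      by (rule has_real_derivative_approx[OF gd \<open>e / 3 > 0\<close>]) (rule that)
    obtain d' where d': "d' > 0" "\<And>h. \<bar>h\<bar> < d' \<Longrightarrow> \<bar>F (t + h) - F t\<bar> \<le> (\<bar>m t\<bar> + e / 3) * \<bar>h\<bar>"
      by (rule has_real_derivative_approx[OF Fm \<open>e / 3 > 0\<close>]) (rule that)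
    have "dist (\<gamma> (t + h)) (\<gamma> t) \<le> \<bar>g i (t + h) - g i t\<bar> + e * \<bar>h\<bar>" if "\<bar>h\<bar> < min d d'" for h
    proof -
      have "dist (\<gamma> (t + h)) (\<gamma> t) \<le> \<bar>F (t + h) - F t\<bar>"
        using dF[of t "t + h"] dF[of "t + h" t] by (cases "h \<ge> 0") (auto simp: dist_commute)
      also have "\<dots> \<le> (\<bar>m t\<bar> + e / 3) * \<bar>h\<bar>" using d'(2)[of h] that by simp
      also have "\<dots> \<le> (\<bar>u i t\<bar> - e / 3 + e) * \<bar>h\<bar>" using i m0[of t] by (intro mult_right_mono) auto
      also have "\<dots> = (\<bar>u i t\<bar> - e / 3) * \<bar>h\<bar> + e * \<bar>h\<bar>" by (simp only: distrib_right)
      also have "\<dots> \<le> \<bar>g i (t + h) - g i t\<bar> + e * \<bar>h\<bar>" using d(2)[of h] that by simp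
      finally show ?thesis .
    qed
    then show "\<exists>i. \<exists>d>0. \<forall>h. \<bar>h\<bar> < d \<longrightarrow> dist (\<gamma> (t + h)) (\<gamma> (t + 0)) \<le>
        \<bar>dist (\<gamma> (t + h)) (y i) - dist (\<gamma> (t + 0)) (y i)\<bar> + e * \<bar>h\<bar>"
      using d(1) d'(1) by (intro exI[of _ i] exI[of _ "min d d'"]) (simp add: g_def)
  qed
  then have "{t. \<not> dist_regular y (\<lambda>h. \<gamma> (t + h))} \<subseteq> N \<union> {t. \<not> (F has_real_derivative m t) (at t)}"
    by blast
  moreover have "negligible (N \<union> {t. \<not> (F has_real_derivative m t) (at t)})"
    by (intro negligible_Un N Lebesgue_differentiation_real F)
  ultimately show ?thesis by (rule negligible_subset[rotated])
qed

section \<open>Null sets and their slices in a fixed direction\<close>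

lemma AE_lborel_translate:
  fixes c :: "'a::euclidean_space"
  assumes "AE x in lborel. P x"
  shows "AE x in lborel. P (x + c)"
proof -
  obtain N where N: "{x. \<not> P x} \<subseteq> N" "N \<in> null_sets lborel"
    using assms unfolding eventually_ae_filter by auto
  have "AE x in distr lborel borel ((+) c). x \<notin> N"
    unfolding lborel_distr_plus by (rule AE_not_in[OF N(2)])
  then have "AE x in lborel. c + x \<notin> N"
    by (subst (asm) AE_distr_iff) (use N(2) in auto)
  then show ?thesis by eventually_elim (use N(1) in \<open>auto simp: add.commute\<close>)
qed

text \<open>Slicing along \<open>t \<mapsto> x + t *\<^sub>R \<nu>\<close> for every \<open>x\<close>, instead of for \<open>x\<close> in a complement of \<open>\<nu>\<close>, avoids a
  change of coordinates: for fixed \<open>t\<close> the map is a translation.\<close>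

lemma AE_lborel_slices_iff:
  fixes \<nu> :: "'a::euclidean_space"
  assumes "S \<in> sets borel"
  shows "(AE x in lborel. AE t in lborel. x + t *\<^sub>R \<nu> \<notin> S) \<longleftrightarrow> (AE t in lborel. AE x in lborel. x + t *\<^sub>R \<nu> \<notin> S)"
proof (rule lborel_pair.AE_commute)
  have [measurable]: "S \<in> sets borel" by fact
  have "{z \<in> space (lborel \<Otimes>\<^sub>M lborel). fst z + snd z *\<^sub>R \<nu> \<notin> S} \<in> sets (lborel \<Otimes>\<^sub>M lborel)"
    by measurable
  then show "{z \<in> space (lborel \<Otimes>\<^sub>M lborel). fst z + snd z *\<^sub>R \<nu> \<notin> S} \<in> sets (lborel \<Otimes>\<^sub>M lborel)" .
qed

text \<open>For fixed \<open>t\<close> a translate of a null set is null. The Borel hull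
  \<open>N'\<close> makes the set in the product measurable, so that the two quantifiers may be
  exchanged.\<close>

lemma null_sets_imp_AE_slices:
  fixes \<nu> :: "'a::euclidean_space"
  assumes "N \<in> null_sets lebesgue"
  shows "AE x in lborel. AE t in lborel. x + t *\<^sub>R \<nu> \<notin> N"
proof -
  obtain N' where N': "N \<subseteq> N'" "N' \<in> null_sets lborel"
    using assms unfolding null_sets_completion_iff2 by auto
  have "AE t in lborel. AE x in lborel. x + t *\<^sub>R \<nu> \<notin> N'"
    by (intro AE_I2 AE_lborel_translate AE_not_in N')
  then have "AE x in lborel. AE t in lborel. x + t *\<^sub>R \<nu> \<notin> N'"
    using N'(2) by (subst AE_lborel_slices_iff) auto
  then show ?thesis by eventually_elim (erule eventually_mono, use N'(1) in auto)
qed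

text \<open>After exchanging the quantifiers a single good \<open>t\<close> suffices: the translate
  of \<open>S\<close> by this \<open>t\<close> is null, and translating back makes \<open>S\<close>
  null. Measurability of \<open>B\<close> enters through its splitting into a Borel set and a
  negligible rest.\<close>

lemma AE_slices_imp_null_sets:
  fixes \<nu> :: "'a::euclidean_space"
  assumes B: "B \<in> sets lebesgue" and AE: "AE x in lborel. AE t in lborel. x + t *\<^sub>R \<nu> \<notin> B"
  shows "B \<in> null_sets lebesgue"
proof -
  obtain S N N' where S: "B = S \<union> N" "N \<subseteq> N'" "N' \<in> null_sets lborel" "S \<in> sets lborel"
    using B by (rule sets_completionE)
  have "AE x in lborel. AE t in lborel. x + t *\<^sub>R \<nu> \<notin> S"
    using AE by eventually_elim (erule eventually_mono, use S(1) in auto)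
  then have "AE t in lborel. AE x in lborel. x + t *\<^sub>R \<nu> \<notin> S"
    using S(4) by (subst (asm) AE_lborel_slices_iff) auto
  moreover have "ae_filter (lborel :: real measure) \<noteq> bot" by (simp add: ae_filter_eq_bot_iff)
  ultimately have "\<exists>t. AE x in lborel. x + t *\<^sub>R \<nu> \<notin> S" by (rule eventually_happens'[rotated])
  then obtain t where "AE x in lborel. x + t *\<^sub>R \<nu> \<notin> S" by blast
  from AE_lborel_translate[OF this, of "- t *\<^sub>R \<nu>"] have "AE x in lborel. x \<notin> S" by simp
  then have "S \<in> null_sets lborel" using S(4) by (subst AE_iff_null_sets) auto
  then have "S \<union> N' \<in> null_sets lborel" using S(3) by auto
  moreover have "B \<subseteq> S \<union> N'" using S(1,2) by auto
  ultimately show ?thesis unfolding null_sets_completion_iff2 by blast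
qed

section \<open>Regular points on lines\<close>

text \<open>Regularity depends only on the germ of the curve at 0, so a clamped curve and the
  original share it at interior points.\<close>

lemma dist_regular_cong:
  assumes eq: "eventually (\<lambda>h. c h = c' h) (nhds 0)" and reg: "dist_regular y c"
  shows "dist_regular y c'"
proof -
  obtain r where r: "r > 0" "\<And>h. \<bar>h\<bar> < r \<Longrightarrow> c h = c' h"
    using eq unfolding eventually_nhds_metric dist_real_def by auto
  have c0: "c 0 = c' 0" using r by simp
  have ev: "eventually (\<lambda>h. c h = c' h) (at 0)" using eq by (simp add: eventually_at_filter eventually_mono)
  show ?thesis
    unfolding dist_regular_def
  proof (intro conjI allI impI)
    fix i
    obtain D where D: "((\<lambda>h. (dist (c h) (y i) - dist (c 0) (y i)) / h) \<longlongrightarrow> D) (at 0)"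
      using reg unfolding dist_regular_def by blast
    have "((\<lambda>h. (dist (c' h) (y i) - dist (c' 0) (y i)) / h) \<longlongrightarrow> D) (at 0)"
      by (rule Lim_transform_eventually[OF D], use ev in eventually_elim) (simp add: c0)
    then show "\<exists>D. ((\<lambda>h. (dist (c' h) (y i) - dist (c' 0) (y i)) / h) \<longlongrightarrow> D) (at 0)" ..
  next
    fix e :: real assume "e > 0"
    then obtain i d where d: "d > 0" "\<And>h. \<bar>h\<bar> < d \<Longrightarrow>
        dist (c h) (c 0) \<le> \<bar>dist (c h) (y i) - dist (c 0) (y i)\<bar> + e * \<bar>h\<bar>"
      using reg unfolding dist_regular_def by blast
    have "dist (c' h) (c' 0) \<le> \<bar>dist (c' h) (y i) - dist (c' 0) (y i)\<bar> + e * \<bar>h\<bar>" if "\<bar>h\<bar> < min d r" for h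
      using d(2)[of h] r(2)[of h] that by (simp add: c0)
    with d(1) r(1) show "\<exists>i. \<exists>d>0. \<forall>h. \<bar>h\<bar> < d \<longrightarrow>
        dist (c' h) (c' 0) \<le> \<bar>dist (c' h) (y i) - dist (c' 0) (y i)\<bar> + e * \<bar>h\<bar>"
      by (intro exI[of _ i] exI[of _ "min d r"]) auto
  qed
qed

lemma AE_lborel_negligible_iff:
  "(AE t in lborel. P t) \<longleftrightarrow> negligible {t. \<not> P t}"
proof -
  have "(AE t in lborel. P t) \<longleftrightarrow> (AE t in lebesgue. P t)" by (simp add: AE_completion_iff)
  also have "\<dots> \<longleftrightarrow> negligible {t. \<not> P t}"
    unfolding negligible_iff_null_sets eventually_ae_filter using null_sets_completion_subset by auto
  finally show ?thesis .
qed

lemma open_contains_rational_interval: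
  fixes T :: "real set"
  assumes "open T" "t \<in> T"
  obtains p q :: rat where "of_rat p < t" "t < of_rat q" "{of_rat p..of_rat q} \<subseteq> T"
proof -
  obtain e where e: "e > 0" "ball t e \<subseteq> T" by (rule openE[OF assms])
  obtain p where p: "t - e < of_rat p" "of_rat p < t" using of_rat_dense[of "t - e" t] e(1) by auto
  obtain q where q: "t < of_rat q" "of_rat q < t + e" using of_rat_dense[of t "t + e"] e(1) by auto
  have "{of_rat p..of_rat q} \<subseteq> ball t e" using p q by (auto simp: dist_real_def)
  with e(2) that[OF p(2) q(1)] show thesis by blast
qed

text \<open>Every point of \<open>T\<close> is interior to one of countably many rational compact
  intervals in \<open>T\<close>. Clamping the parameter to such an interval yields a curve on the
  whole line that is constant beyond both ends.\<close>

lemma locally_abs_cont_dist_regular: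
  fixes \<gamma> :: "real \<Rightarrow> 'x::metric_space" and y :: "nat \<Rightarrow> 'x"
  assumes "open T"
    and ac: "\<And>a b. a < b \<Longrightarrow> {a..b} \<subseteq> T \<Longrightarrow> abs_cont_on_interval (\<lambda>t. \<gamma> (a + t * (b - a))) 0 1"
    and sep: "AE t in lborel. t \<in> T \<longrightarrow> \<gamma> t \<in> closure (range y)"
  shows "continuous_on T \<gamma>" "\<And>t. t \<in> T \<Longrightarrow> \<gamma> t \<in> closure (range y)"
    "AE t in lborel. t \<in> T \<longrightarrow> dist_regular y (\<lambda>h. \<gamma> (t + h))"
proof -
  define clamp where "clamp a b t = max a (min b t)" for a b t :: real
  have uac: "uniformly_abs_cont (\<lambda>t. \<gamma> (clamp a b t))" if "a < b" "{a..b} \<subseteq> T" for a b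
  proof -
    \<comment> \<open>Absolute continuity on segments is tested over \<open>{0..1}\<close>, so the
      clamp is rescaled; this is where \<open>K = 1 / (b - a)\<close> comes from.\<close>
    define c where "c t = (clamp a b t - a) / (b - a)" for t
    have "uniformly_abs_cont (\<lambda>u. \<gamma> (a + c u * (b - a)))"
    proof (rule abs_cont_on_interval_reparametrize[OF ac[OF that], where K = "1 / (b - a)"])
      show "mono c" using that(1) by (intro monoI) (auto simp: c_def clamp_def intro!: divide_right_mono)
      show "c u \<in> {0..1}" for u using that(1) by (auto simp: c_def clamp_def)
      show "c v - c u \<le> 1 / (b - a) * (v - u)" if "u \<le> v" for u v
      proof -
        have "c v - c u = (clamp a b v - clamp a b u) / (b - a)" by (simp add: c_def diff_divide_distrib)
        also have "\<dots> \<le> (v - u) / (b - a)"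
          using that \<open>a < b\<close> by (intro divide_right_mono) (auto simp: clamp_def)
        finally show ?thesis by simp
      qed
    qed (use that in auto)
    moreover have "a + c u * (b - a) = clamp a b u" for u using that(1) by (simp add: c_def)
    ultimately show ?thesis by simp
  qed
  show cont: "continuous_on T \<gamma>"
    unfolding continuous_on_eq_continuous_at[OF \<open>open T\<close>]
  proof
    fix t assume "t \<in> T"
    then obtain p q where pq: "of_rat p < t" "t < of_rat q" "{of_rat p..of_rat q} \<subseteq> T"
      using open_contains_rational_interval[OF \<open>open T\<close>] by blast
    then have "continuous_on UNIV (\<lambda>t. \<gamma> (clamp (of_rat p) (of_rat q) t))"
      by (intro uniformly_abs_cont_imp_continuous uac) auto
    then have "continuous_on {of_rat p<..<of_rat q} (\<lambda>t. \<gamma> (clamp (of_rat p) (of_rat q) t))"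
      by (rule continuous_on_subset) simp
    then have "continuous_on {of_rat p<..<of_rat q} \<gamma>"
      by (rule continuous_on_eq) (auto simp: clamp_def)
    then show "isCont \<gamma> t" using pq(1,2) by (simp add: continuous_on_eq_continuous_at)
  qed
  \<comment> \<open>Parameters at which the curve leaves the closure form an open set by continuity
    and a null set by assumption, so there are none.\<close>
  show sepT: "\<gamma> t \<in> closure (range y)" if "t \<in> T" for t
  proof -
    have "open (T \<inter> \<gamma> -` (- closure (range y)))"
      by (rule continuous_open_preimage[OF cont \<open>open T\<close>]) auto
    moreover have "negligible (T \<inter> \<gamma> -` (- closure (range y)))"
      using sep unfolding AE_lborel_negligible_iff by (rule negligible_subset) auto
    ultimately have "T \<inter> \<gamma> -` (- closure (range y)) = {}" using open_not_negligible by blast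
    with that show ?thesis by auto
  qed
  have "AE t in lborel. \<forall>p q :: rat. p < q \<and> {of_rat p..of_rat q} \<subseteq> T \<longrightarrow>
      dist_regular y (\<lambda>h. \<gamma> (clamp (of_rat p) (of_rat q) (t + h)))"
    unfolding AE_all_countable
  proof (intro allI)
    fix p q :: rat
    show "AE t in lborel. p < q \<and> {of_rat p..of_rat q} \<subseteq> T \<longrightarrow>
      dist_regular y (\<lambda>h. \<gamma> (clamp (of_rat p) (of_rat q) (t + h)))"
    proof (cases "p < q \<and> {of_rat p..of_rat q} \<subseteq> T")
      case True
      let ?a = "of_rat p :: real" and ?b = "of_rat q :: real"
      have ab: "?a < ?b" "{?a..?b} \<subseteq> T" using True by (auto simp: of_rat_less)
      have "negligible {t. \<not> dist_regular y (\<lambda>h. \<gamma> (clamp ?a ?b (t + h)))}"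
      proof (rule negligible_not_dist_regular[OF uac[OF ab]])
        fix u
        show "\<gamma> (clamp ?a ?b u) = \<gamma> (clamp ?a ?b ?a)" if "u \<le> ?a" using that ab by (simp add: clamp_def)
        show "\<gamma> (clamp ?a ?b u) = \<gamma> (clamp ?a ?b ?b)" if "?b \<le> u" using that ab by (simp add: clamp_def)
        have "clamp ?a ?b u \<in> {?a..?b}" using ab by (auto simp: clamp_def)
        then show "\<gamma> (clamp ?a ?b u) \<in> closure (range y)" using ab sepT by blast
      qed
      then show ?thesis by (simp add: AE_lborel_negligible_iff True)
    next
      case False
      then show ?thesis by (intro AE_I2) blast
    qed
  qed
  then show "AE t in lborel. t \<in> T \<longrightarrow> dist_regular y (\<lambda>h. \<gamma> (t + h))"
  proof eventually_elim
    case (elim t)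
    show ?case
    proof
      assume "t \<in> T"
      then obtain p q where pq: "of_rat p < t" "t < of_rat q" "{of_rat p..of_rat q} \<subseteq> T"
        using open_contains_rational_interval[OF \<open>open T\<close>] by blast
      have "p < q" using pq(1,2) by (metis less_trans of_rat_less)
      then have "dist_regular y (\<lambda>h. \<gamma> (clamp (of_rat p) (of_rat q) (t + h)))" using elim pq by blast
      moreover have "eventually (\<lambda>h. h \<in> {of_rat p - t<..<of_rat q - t}) (nhds 0)"
        using pq by (intro eventually_nhds_in_open) auto
      then have "eventually (\<lambda>h. \<gamma> (clamp (of_rat p) (of_rat q) (t + h)) = \<gamma> (t + h)) (nhds 0)"
        by eventually_elim (auto simp: clamp_def)
      ultimately show "dist_regular y (\<lambda>h. \<gamma> (t + h))" by (rule dist_regular_cong[rotated])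
    qed
  qed
qed

text \<open>Countably many conditions that are equivalent to \<^const>\<open>dist_regular\<close> along a continuous curve,
  so that the set of regular points becomes measurable.\<close>

definition rat_regular :: "(nat \<Rightarrow> real \<Rightarrow> real) \<Rightarrow> bool"
  where "rat_regular G \<longleftrightarrow>
    (\<forall>i. \<forall>n::nat. \<exists>D::rat. \<exists>m::nat. \<forall>h::rat. \<bar>of_rat h\<bar> < inverse (Suc m) \<longrightarrow>
       \<bar>G i (of_rat h) - G i 0 - of_rat D * of_rat h\<bar> \<le> inverse (Suc n) * \<bar>of_rat h\<bar>) \<and>
    (\<forall>n::nat. \<exists>i. \<exists>m::nat. \<forall>h::rat. \<bar>of_rat h\<bar> < inverse (Suc m) \<longrightarrow>
       (\<forall>j. \<bar>G j (of_rat h) - G j 0\<bar> \<le> \<bar>G i (of_rat h) - G i 0\<bar> + inverse (Suc n) * \<bar>of_rat h\<bar>))"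

lemma sets_rat_regular:
  assumes g: "\<And>i h. (\<lambda>x. g i h x) \<in> borel_measurable M"
  shows "{x \<in> space M. rat_regular (\<lambda>i h. g i h x)} \<in> sets M"
proof -
  note [measurable] = g
  show ?thesis unfolding rat_regular_def by measurable
qed

text \<open>Agreement of \<open>G\<close> with the distances is asked for small \<open>h\<close>
  only, because the functions inserted later are 0 outside \<open>\<Omega>\<close>.\<close>

lemma dist_regular_imp_rat_regular:
  assumes reg: "dist_regular y c" and "r > 0" and G: "\<And>i h. \<bar>h\<bar> < r \<Longrightarrow> G i h = dist (c h) (y i)"
  shows "rat_regular G"
proof -
  have small: "\<exists>m. inverse (Suc m) < min d r" if "d > 0" for d
    using reals_Archimedean[of "min d r"] that \<open>r > 0\<close> by auto
  have G0: "G i 0 = dist (c 0) (y i)" for i using G \<open>r > 0\<close> by simp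
  show ?thesis
    unfolding rat_regular_def
  proof (intro conjI allI)
    fix i and n :: nat
    define e where "e = inverse (real (Suc n))"
    have "e > 0" by (simp add: e_def)
    obtain D where D: "((\<lambda>h. (dist (c h) (y i) - dist (c 0) (y i)) / h) \<longlongrightarrow> D) (at 0)"
      using reg unfolding dist_regular_def by blast
    \<comment> \<open>The slope must be rational to keep the conditions countable. Half of the
      tolerance pays for replacing \<open>D\<close>, the other half for the difference
      quotient.\<close>
    obtain D' where D': "D - e / 2 < of_rat D'" "of_rat D' < D + e / 2"
      using of_rat_dense[of "D - e / 2" "D + e / 2"] \<open>e > 0\<close> by auto
    obtain d where d: "d > 0" "\<And>h. h \<noteq> 0 \<Longrightarrow> \<bar>h\<bar> < d \<Longrightarrow> \<bar>(dist (c h) (y i) - dist (c 0) (y i)) / h - D\<bar> < e / 2"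
      using D \<open>e > 0\<close> unfolding tendsto_iff eventually_at dist_real_def by (metis UNIV_I diff_zero half_gt_zero)
    obtain m where m: "inverse (Suc m) < min d r" using small[OF d(1)] by blast
    have "\<bar>G i h - G i 0 - of_rat D' * h\<bar> \<le> e * \<bar>h\<bar>" if "\<bar>h\<bar> < inverse (Suc m)" for h
    proof (cases "h = 0")
      case False
      define Q where "Q = (G i h - G i 0) / h"
      have Gh: "G i h - G i 0 = Q * h" using False by (simp add: Q_def)
      have "\<bar>Q - D\<bar> < e / 2" unfolding Q_def using d(2)[OF False] G[of h] G0 that m by simp
      then have "\<bar>Q - of_rat D'\<bar> \<le> e" using D' by linarith
      then have "\<bar>Q - of_rat D'\<bar> * \<bar>h\<bar> \<le> e * \<bar>h\<bar>" by (rule mult_right_mono) simp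
      then show ?thesis unfolding Gh by (simp add: abs_mult[symmetric] left_diff_distrib)
    qed simp
    then show "\<exists>D::rat. \<exists>m::nat. \<forall>h::rat. \<bar>of_rat h\<bar> < inverse (real (Suc m)) \<longrightarrow>
        \<bar>G i (of_rat h) - G i 0 - of_rat D * of_rat h\<bar> \<le> inverse (real (Suc n)) * \<bar>of_rat h\<bar>"
      unfolding e_def[symmetric] by blast
  next
    fix n :: nat
    define e where "e = inverse (real (Suc n))"
    have "e > 0" by (simp add: e_def)
    then obtain i d where d: "d > 0" "\<And>h. \<bar>h\<bar> < d \<Longrightarrow>
          dist (c h) (c 0) \<le> \<bar>dist (c h) (y i) - dist (c 0) (y i)\<bar> + e * \<bar>h\<bar>"
      using reg unfolding dist_regular_def by blast
    obtain m where m: "inverse (Suc m) < min d r" using small[OF d(1)] by blast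
    have "\<bar>G j h - G j 0\<bar> \<le> \<bar>G i h - G i 0\<bar> + e * \<bar>h\<bar>" if "\<bar>h\<bar> < inverse (Suc m)" for h j
    proof -
      have h: "\<bar>h\<bar> < d" "\<bar>h\<bar> < r" using that m by auto
      \<comment> \<open>The increments for all \<open>j\<close> stand in for
        \<open>dist (c h) (c 0)\<close>, which \<open>G\<close> does not express directly: each is
        at most this distance, and in the converse a \<open>y j\<close> close to \<open>c 0\<close>
        recovers it.\<close>
      have "\<bar>dist (c h) (y j) - dist (c 0) (y j)\<bar> \<le> dist (c h) (c 0)"
        using abs_dist_diff_le[of "c h" "y j" "c 0"] by (simp add: dist_commute)
      then show ?thesis using d(2)[OF h(1)] by (simp add: G[OF h(2)] G0)
    qed
    then show "\<exists>i. \<exists>m::nat. \<forall>h::rat. \<bar>of_rat h\<bar> < inverse (real (Suc m)) \<longrightarrow>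
         (\<forall>j. \<bar>G j (of_rat h) - G j 0\<bar> \<le> \<bar>G i (of_rat h) - G i 0\<bar> + inverse (real (Suc n)) * \<bar>of_rat h\<bar>)"
      unfolding e_def[symmetric] by blast
  qed
qed

lemma continuous_le_of_rat_le:
  fixes \<phi> \<psi> :: "real \<Rightarrow> real"
  assumes "continuous_on {a<..<b} \<phi>" "continuous_on {a<..<b} \<psi>"
    and le: "\<And>p :: rat. of_rat p \<in> {a<..<b} \<Longrightarrow> \<phi> (of_rat p) \<le> \<psi> (of_rat p)" and h: "h \<in> {a<..<b}"
  shows "\<phi> h \<le> \<psi> h"
proof (rule ccontr)
  assume "\<not> \<phi> h \<le> \<psi> h"
  let ?U = "{a<..<b} \<inter> (\<lambda>u. \<phi> u - \<psi> u) -` {0<..}"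
  have "open ?U"
    by (intro continuous_open_preimage continuous_on_diff assms) auto
  moreover have "h \<in> ?U" using h \<open>\<not> \<phi> h \<le> \<psi> h\<close> by auto
  ultimately obtain p q where pq: "of_rat p < h" "h < of_rat q" "{of_rat p..of_rat q} \<subseteq> ?U"
    by (rule open_contains_rational_interval)
  then have "of_rat p \<in> ?U" by (intro subsetD[OF pq(3)]) auto
  then show False using le[of p] by auto
qed

text \<open>\<open>rat_regular\<close> supplies a separate slope for each accuracy and never the
  derivative itself. Two slopes can be compared at a common small \<open>h\<close>, so those for the
  accuracies \<open>inverse (Suc n)\<close> are Cauchy, and their limit is the derivative.\<close>

lemma approximately_linear_imp_tendsto:
  fixes u :: "real \<Rightarrow> real"
  assumes approx: "\<And>e. e > 0 \<Longrightarrow> \<exists>D. \<exists>d>0. \<forall>h. \<bar>h\<bar> < d \<longrightarrow> \<bar>u h - D * h\<bar> \<le> e * \<bar>h\<bar>"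
  shows "\<exists>D. ((\<lambda>h. u h / h) \<longlongrightarrow> D) (at 0)"
proof -
  have approx': "\<exists>D. \<exists>d>0. \<forall>h. h \<noteq> 0 \<and> \<bar>h\<bar> < d \<longrightarrow> \<bar>u h / h - D\<bar> \<le> e" if e: "e > 0" for e
  proof -
    obtain D d where d: "d > 0" "\<And>h. \<bar>h\<bar> < d \<Longrightarrow> \<bar>u h - D * h\<bar> \<le> e * \<bar>h\<bar>"
      using approx[OF e] by blast
    have "\<bar>u h / h - D\<bar> \<le> e" if "h \<noteq> 0" "\<bar>h\<bar> < d" for h
    proof -
      have "u h / h - D = (u h - D * h) / h" using that(1) by (simp add: diff_divide_distrib)
      then show ?thesis using d(2)[OF that(2)] that(1) by (simp add: abs_divide pos_divide_le_eq)
    qed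
    with d(1) show ?thesis by blast
  qed
  have "\<forall>n::nat. \<exists>D. \<exists>d>0. \<forall>h. h \<noteq> 0 \<and> \<bar>h\<bar> < d \<longrightarrow> \<bar>u h / h - D\<bar> \<le> inverse (Suc n)"
    by (intro allI approx') simp
  then obtain D d where d: "\<And>n::nat. d n > 0"
    "\<And>n h. h \<noteq> 0 \<Longrightarrow> \<bar>h\<bar> < d n \<Longrightarrow> \<bar>u h / h - D n\<bar> \<le> inverse (Suc n)" by metis
  have DD: "\<bar>D n - D m\<bar> \<le> inverse (Suc n) + inverse (Suc m)" for n m
  proof -
    define h where "h = min (d n) (d m) / 2"
    have "h > 0" "\<bar>h\<bar> < d n" "\<bar>h\<bar> < d m" using d(1)[of n] d(1)[of m] by (auto simp: h_def min_def)
    then show ?thesis using d(2)[of h n] d(2)[of h m] by linarith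
  qed
  have "Cauchy D"
  proof (rule metric_CauchyI)
    fix e :: real assume "e > 0"
    obtain M where M: "inverse (real (Suc M)) < e / 2" using reals_Archimedean[of "e / 2"] \<open>e > 0\<close> by auto
    have small: "inverse (real (Suc n)) < e / 2" if "n \<ge> M" for n
    proof -
      have "inverse (real (Suc n)) \<le> inverse (real (Suc M))" using that by (intro le_imp_inverse_le) auto
      with M show ?thesis by linarith
    qed
    have "dist (D n) (D m) < e" if "n \<ge> M" "m \<ge> M" for n m
      using DD[of n m] small[OF that(1)] small[OF that(2)] unfolding dist_real_def by linarith
    then show "\<exists>M. \<forall>m\<ge>M. \<forall>n\<ge>M. dist (D m) (D n) < e" by blast
  qed
  then obtain L where L: "D \<longlonglongrightarrow> L" using Cauchy_convergent_iff convergent_def by blast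
  have "((\<lambda>h. u h / h) \<longlongrightarrow> L) (at 0)"
    unfolding tendsto_iff
  proof (intro allI impI)
    fix e :: real assume "e > 0"
    then have "eventually (\<lambda>n. dist (D n) L < e / 2) sequentially" using L by (intro tendstoD) auto
    moreover have "eventually (\<lambda>n. inverse (real (Suc n)) < e / 2) sequentially"
      using LIMSEQ_inverse_real_of_nat \<open>e > 0\<close> by (intro order_tendstoD(2)) auto
    ultimately have "eventually (\<lambda>n. dist (D n) L < e / 2 \<and> inverse (real (Suc n)) < e / 2) sequentially"
      by (rule eventually_conj)
    then obtain n where n: "dist (D n) L < e / 2" "inverse (real (Suc n)) < e / 2"
      using eventually_happens'[OF sequentially_bot] by blast
    have "dist (u h / h) L < e" if "h \<noteq> 0" "\<bar>h\<bar> < d n" for h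
      using d(2)[OF that] n unfolding dist_real_def by linarith
    then show "eventually (\<lambda>h. dist (u h / h) L < e) (at 0)"
      unfolding eventually_at using d(1)[of n] by (auto simp: dist_real_def)
  qed
  then show ?thesis ..
qed

text \<open>Continuity of \<open>c\<close> extends the inequalities from rational to real
  \<open>h\<close>; the closure condition turns distances to the \<open>y j\<close> back into
  \<open>dist (c h) (c 0)\<close>.\<close>

lemma rat_regular_imp_dist_regular:
  fixes c :: "real \<Rightarrow> 'x::metric_space"
  assumes reg: "rat_regular G" and "r > 0" and G: "\<And>i h. \<bar>h\<bar> < r \<Longrightarrow> G i h = dist (c h) (y i)"
    and cont: "continuous_on {-r<..<r} c" and sep: "c 0 \<in> closure (range y)"
  shows "dist_regular y c"
  unfolding dist_regular_def
proof (intro conjI allI impI)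
  fix i
  show "\<exists>D. ((\<lambda>h. (dist (c h) (y i) - dist (c 0) (y i)) / h) \<longlongrightarrow> D) (at 0)"
  proof (rule approximately_linear_imp_tendsto)
    fix e :: real assume "e > 0"
    then obtain n where n: "inverse (real (Suc n)) < e" using reals_Archimedean by blast
    obtain D :: rat and m :: nat where m: "\<And>h::rat. \<bar>of_rat h\<bar> < inverse (real (Suc m)) \<Longrightarrow>
       \<bar>G i (of_rat h) - G i 0 - of_rat D * of_rat h\<bar> \<le> inverse (Suc n) * \<bar>of_rat h\<bar>"
      using reg unfolding rat_regular_def by blast
    define d where "d = min r (inverse (real (Suc m)))"
    have "d > 0" using \<open>r > 0\<close> by (simp add: d_def)
    have contd: "continuous_on {-d<..<d} c" by (rule continuous_on_subset[OF cont]) (auto simp: d_def)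
    have "\<bar>dist (c h) (y i) - dist (c 0) (y i) - of_rat D * h\<bar> \<le> inverse (Suc n) * \<bar>h\<bar>" if "\<bar>h\<bar> < d" for h
    proof (rule continuous_le_of_rat_le[where a = "- d" and b = d and h = h
          and \<phi> = "\<lambda>h. \<bar>dist (c h) (y i) - dist (c 0) (y i) - of_rat D * h\<bar>"
          and \<psi> = "\<lambda>h. inverse (Suc n) * \<bar>h\<bar>"])
      fix p :: rat assume "of_rat p \<in> {- d<..<d}"
      then have "\<bar>of_rat p :: real\<bar> < d" unfolding abs_less_iff by auto
      then show "\<bar>dist (c (of_rat p)) (y i) - dist (c 0) (y i) - of_rat D * of_rat p\<bar> \<le> inverse (Suc n) * \<bar>of_rat p\<bar>"
        using m[of p] G[of "of_rat p" i] G[of 0 i] \<open>r > 0\<close> by (simp add: d_def)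
    qed (use that contd in \<open>auto intro!: continuous_intros\<close>)
    then have "\<bar>dist (c h) (y i) - dist (c 0) (y i) - of_rat D * h\<bar> \<le> e * \<bar>h\<bar>" if "\<bar>h\<bar> < d" for h
      using that mult_right_mono[OF less_imp_le[OF n], of "\<bar>h\<bar>"] by fastforce
    with \<open>d > 0\<close> show "\<exists>D. \<exists>d>0. \<forall>h. \<bar>h\<bar> < d \<longrightarrow>
        \<bar>dist (c h) (y i) - dist (c 0) (y i) - D * h\<bar> \<le> e * \<bar>h\<bar>" by blast
  qed
next
  fix e :: real assume "e > 0"
  then obtain n where n: "inverse (real (Suc n)) < e" using reals_Archimedean by blast
  obtain i and m :: nat where m: "\<And>(h::rat) j. \<bar>of_rat h\<bar> < inverse (real (Suc m)) \<Longrightarrow>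
       \<bar>G j (of_rat h) - G j 0\<bar> \<le> \<bar>G i (of_rat h) - G i 0\<bar> + inverse (Suc n) * \<bar>of_rat h\<bar>"
    using reg unfolding rat_regular_def by blast
  define d where "d = min r (inverse (real (Suc m)))"
  have "d > 0" using \<open>r > 0\<close> by (simp add: d_def)
  have contd: "continuous_on {-d<..<d} c" by (rule continuous_on_subset[OF cont]) (auto simp: d_def)
  have *: "\<bar>dist (c h) (y j) - dist (c 0) (y j)\<bar> \<le> \<bar>dist (c h) (y i) - dist (c 0) (y i)\<bar> + inverse (Suc n) * \<bar>h\<bar>"
    if "\<bar>h\<bar> < d" for h j
  proof (rule continuous_le_of_rat_le[where a = "- d" and b = d and h = h
        and \<phi> = "\<lambda>h. \<bar>dist (c h) (y j) - dist (c 0) (y j)\<bar>"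
        and \<psi> = "\<lambda>h. \<bar>dist (c h) (y i) - dist (c 0) (y i)\<bar> + inverse (Suc n) * \<bar>h\<bar>"])
    fix p :: rat assume "of_rat p \<in> {- d<..<d}"
    then have "\<bar>of_rat p :: real\<bar> < d" unfolding abs_less_iff by auto
    then show "\<bar>dist (c (of_rat p)) (y j) - dist (c 0) (y j)\<bar> \<le>
        \<bar>dist (c (of_rat p)) (y i) - dist (c 0) (y i)\<bar> + inverse (Suc n) * \<bar>of_rat p\<bar>"
      using m[of p j] G[of "of_rat p"] G[of 0] \<open>r > 0\<close> by (simp add: d_def)
  qed (use that contd in \<open>auto intro!: continuous_intros\<close>)
  have "dist (c h) (c 0) \<le> \<bar>dist (c h) (y i) - dist (c 0) (y i)\<bar> + e * \<bar>h\<bar>" if "\<bar>h\<bar> < d" for h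
  proof (rule field_le_epsilon)
    fix e' :: real assume "e' > 0"
    then have "e' / 2 > 0" by simp
    then obtain j where j: "dist (y j) (c 0) < e' / 2"
      using sep unfolding closure_approachable by blast
    have "dist (c h) (c 0) \<le> dist (c h) (y j) + dist (c 0) (y j)" by (rule dist_triangle2)
    also have "\<dots> \<le> \<bar>dist (c h) (y j) - dist (c 0) (y j)\<bar> + e'" using j by (simp add: dist_commute)
    also have "\<dots> \<le> \<bar>dist (c h) (y i) - dist (c 0) (y i)\<bar> + inverse (Suc n) * \<bar>h\<bar> + e'" using *[OF that] by simp
    also have "\<dots> \<le> \<bar>dist (c h) (y i) - dist (c 0) (y i)\<bar> + e * \<bar>h\<bar> + e'"
      using mult_right_mono[OF less_imp_le[OF n], of "\<bar>h\<bar>"] by simp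
    finally show "dist (c h) (c 0) \<le> \<bar>dist (c h) (y i) - dist (c 0) (y i)\<bar> + e * \<bar>h\<bar> + e'" .
  qed
  with \<open>d > 0\<close> show "\<exists>i. \<exists>d>0. \<forall>h. \<bar>h\<bar> < d \<longrightarrow>
      dist (c h) (c 0) \<le> \<bar>dist (c h) (y i) - dist (c 0) (y i)\<bar> + e * \<bar>h\<bar>" by blast
qed

section \<open>From lines to almost every point of the domain\<close>

lemma ess_separably_valuedE:
  fixes f :: "real^'n \<Rightarrow> 'x::metric_space"
  assumes "ess_separably_valued \<Omega> f"
  obtains N and y :: "nat \<Rightarrow> 'x" where "N \<in> null_sets lebesgue" "f ` (\<Omega> - N) \<subseteq> closure (range y)"
proof -
  obtain N C where N: "N \<in> null_sets lebesgue" and C: "countable C" "C \<subseteq> f ` (\<Omega> - N)"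
    "(top_of_set (f ` (\<Omega> - N))) closure_of C = f ` (\<Omega> - N)"
    using assms unfolding ess_separably_valued_def separable_space_def by auto
  have sub: "f ` (\<Omega> - N) \<subseteq> closure C"
    using C(3) by (metis closure_of_subtopology_subset euclidean_closure_of)
  show thesis
  proof (cases "C = {}")
    case True
    then have empty: "f ` (\<Omega> - N) = {}" using sub by simp
    \<comment> \<open>The image is empty, so an arbitrary sequence serves.\<close>
    show thesis by (rule that[OF N, of "\<lambda>_. undefined"]) (simp only: empty empty_subsetI)
  next
    case False
    then show thesis using that[OF N, of "from_nat_into C"] sub C(1) by (simp add: range_from_nat_into)
  qed
qed

text \<open>Stated for the completed measure because \<open>f\<close>, and with it each distance
  function, is only Lebesgue measurable.\<close>

lemma measurable_lebesgue_translate: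
  "(\<lambda>x :: 'a::euclidean_space. x + c) \<in> lebesgue \<rightarrow>\<^sub>M lebesgue"
  using lebesgue_affine_measurable[of "\<lambda>_. 1" c] by (simp add: euclidean_representation add.commute)

text \<open>Almost every slice meets the uncovered part of \<open>\<Omega>\<close> in a null set of
  parameters. If the slice contains an interval in \<open>\<Omega>\<close>, its parameters in
  \<open>\<Omega>\<close> form a nonempty open set, so one of its points lies on a line of
  \<open>L\<close>; being parallel to that line, the whole slice lies on it.\<close>

lemma abs_cont_on_ae_segment_AE_line:
  fixes f :: "real^'n \<Rightarrow> 'x::metric_space"
  assumes "open \<Omega>" and ac: "abs_cont_on_ae_segment \<Omega> \<nu> f"
  shows "AE x in lborel. \<forall>a b. a < b \<and> {a..b} \<subseteq> {t. x + t *\<^sub>R \<nu> \<in> \<Omega>} \<longrightarrow>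
    abs_cont_on_interval (\<lambda>t. f (x + (a + t * (b - a)) *\<^sub>R \<nu>)) 0 1"
proof -
  obtain L where L: "\<forall>l\<in>L. \<exists>p. l = range (\<lambda>t. p + t *\<^sub>R \<nu>)" "\<Omega> - \<Union>L \<in> null_sets lebesgue"
    "\<forall>l\<in>L. \<forall>p q. closed_segment p q \<subseteq> l \<inter> \<Omega> \<longrightarrow> abs_cont_on_segment f p q"
    using ac unfolding abs_cont_on_ae_segment_def by (elim exE conjE) (rule that)
  have "AE x in lborel. AE t in lborel. x + t *\<^sub>R \<nu> \<notin> \<Omega> - \<Union>L"
    by (rule null_sets_imp_AE_slices[OF L(2)])
  then show ?thesis
  proof eventually_elim
    case (elim x)
    let ?T = "{t. x + t *\<^sub>R \<nu> \<in> \<Omega>}"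
    have "open ?T"
      using continuous_open_preimage[of UNIV "\<lambda>t. x + t *\<^sub>R \<nu>" \<Omega>] \<open>open \<Omega>\<close>
      by (simp add: vimage_def continuous_intros)
    show ?case
    proof (intro allI impI)
      fix a b assume ab: "a < b \<and> {a..b} \<subseteq> ?T"
      then have "a \<in> {a..b}" by simp
      with ab have "a \<in> ?T" by blast
      then have "\<not> negligible ?T" using open_not_negligible[OF \<open>open ?T\<close>] by blast
      moreover have "negligible {t. \<not> x + t *\<^sub>R \<nu> \<notin> \<Omega> - \<Union>L}"
        using elim by (simp only: AE_lborel_negligible_iff)
      ultimately have "\<not> ?T \<subseteq> {t. \<not> x + t *\<^sub>R \<nu> \<notin> \<Omega> - \<Union>L}" using negligible_subset by blast
      then obtain s l where l: "l \<in> L" "x + s *\<^sub>R \<nu> \<in> l" by auto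
      then obtain p where p: "l = range (\<lambda>t. p + t *\<^sub>R \<nu>)" using L(1) by blast
      then obtain s' where "x + s *\<^sub>R \<nu> = p + s' *\<^sub>R \<nu>" using l by auto
      then have x: "x = p + (s' - s) *\<^sub>R \<nu>" by (simp add: algebra_simps)
      have on_l: "x + t *\<^sub>R \<nu> \<in> l" for t
        unfolding p by (rule image_eqI[of _ _ "s' - s + t"]) (simp_all add: x algebra_simps)
      have par: "(x + a *\<^sub>R \<nu>) + t *\<^sub>R ((x + b *\<^sub>R \<nu>) - (x + a *\<^sub>R \<nu>)) = x + (a + t * (b - a)) *\<^sub>R \<nu>" for t
        by (simp add: algebra_simps)
      have in_\<Omega>: "x + (a + t * (b - a)) *\<^sub>R \<nu> \<in> \<Omega>" if "0 \<le> t" "t \<le> 1" for t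
      proof -
        have "0 \<le> t * (b - a)" "t * (b - a) \<le> 1 * (b - a)"
          using that ab by (simp, intro mult_right_mono) auto
        then have "a + t * (b - a) \<in> {a..b}" by auto
        then show ?thesis using ab by blast
      qed
      have "closed_segment (x + a *\<^sub>R \<nu>) (x + b *\<^sub>R \<nu>) \<subseteq> l \<inter> \<Omega>"
      proof
        fix z assume "z \<in> closed_segment (x + a *\<^sub>R \<nu>) (x + b *\<^sub>R \<nu>)"
        then obtain t where t: "0 \<le> t" "t \<le> 1" "z = (1 - t) *\<^sub>R (x + a *\<^sub>R \<nu>) + t *\<^sub>R (x + b *\<^sub>R \<nu>)"
          by (auto simp: closed_segment_def)
        then have "z = x + (a + t * (b - a)) *\<^sub>R \<nu>" by (simp add: algebra_simps)
        then show "z \<in> l \<inter> \<Omega>" using on_l in_\<Omega>[OF t(1,2)] by simp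
      qed
      then have "abs_cont_on_segment f (x + a *\<^sub>R \<nu>) (x + b *\<^sub>R \<nu>)" using L(3) l(1) by blast
      then show "abs_cont_on_interval (\<lambda>t. f (x + (a + t * (b - a)) *\<^sub>R \<nu>)) 0 1"
        by (simp only: abs_cont_on_segment_def par)
    qed
  qed
qed

lemma AE_dist_regular:
  fixes f :: "real^'n \<Rightarrow> 'x::metric_space" and y :: "nat \<Rightarrow> 'x"
  assumes "open \<Omega>" and f: "f \<in> measurable (lebesgue_on \<Omega>) borel"
    and N: "N \<in> null_sets lebesgue" "f ` (\<Omega> - N) \<subseteq> closure (range y)"
    and ac: "abs_cont_on_ae_segment \<Omega> \<nu> f"
  shows "AE x in lborel. x \<in> \<Omega> \<longrightarrow> dist_regular y (\<lambda>h. f (x + h *\<^sub>R \<nu>))"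
proof -
  define T where "T x = {t. x + t *\<^sub>R \<nu> \<in> \<Omega>}" for x
  have openT: "open (T x)" for x
    using continuous_open_preimage[of UNIV "\<lambda>t. x + t *\<^sub>R \<nu>" \<Omega>] \<open>open \<Omega>\<close>
    by (simp add: T_def vimage_def continuous_intros)
  \<comment> \<open>Continuity and the closure condition are kept for every \<open>t\<close>, hence
    also at \<open>t = 0\<close>, that is, at \<open>x\<close> itself. Regularity holds for almost
    every \<open>t\<close> only, and 0 may be exceptional; passing from \<open>t\<close> to
    \<open>x\<close> is the task of the set \<open>B\<close> below.\<close>
  have line: "AE x in lborel. continuous_on (T x) (\<lambda>t. f (x + t *\<^sub>R \<nu>)) \<and>
      (\<forall>t\<in>T x. f (x + t *\<^sub>R \<nu>) \<in> closure (range y)) \<and>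
      (AE t in lborel. t \<in> T x \<longrightarrow> dist_regular y (\<lambda>h. f (x + (t + h) *\<^sub>R \<nu>)))"
    using abs_cont_on_ae_segment_AE_line[OF \<open>open \<Omega>\<close> ac] null_sets_imp_AE_slices[OF N(1), of \<nu>]
  proof eventually_elim
    case (elim x)
    have "AE t in lborel. t \<in> T x \<longrightarrow> f (x + t *\<^sub>R \<nu>) \<in> closure (range y)"
      using elim(2) by eventually_elim (use N(2) in \<open>auto simp: T_def\<close>)
    moreover have "abs_cont_on_interval (\<lambda>t. f (x + (a + t * (b - a)) *\<^sub>R \<nu>)) 0 1" if "a < b" "{a..b} \<subseteq> T x" for a b
      using elim(1) that unfolding T_def by blast
    ultimately have reg: "continuous_on (T x) (\<lambda>t. f (x + t *\<^sub>R \<nu>))"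
      "\<And>t. t \<in> T x \<Longrightarrow> f (x + t *\<^sub>R \<nu>) \<in> closure (range y)"
      "AE t in lborel. t \<in> T x \<longrightarrow> dist_regular y (\<lambda>h. f (x + (t + h) *\<^sub>R \<nu>))"
      using locally_abs_cont_dist_regular[OF openT[of x], of "\<lambda>t. f (x + t *\<^sub>R \<nu>)" y] by blast+
    show ?case by (intro conjI ballI reg)
  qed
  \<comment> \<open>Extension by 0 makes the distance functions measurable on the whole space, where
    translations act.\<close>
  define g where "g i z = indicator \<Omega> z *\<^sub>R dist (f z) (y i)" for i z
  have "(\<lambda>z. dist (f z) (y i)) \<in> borel_measurable (lebesgue_on \<Omega>)" for i
    by (rule measurable_compose[OF f]) (intro borel_measurable_continuous_onI continuous_intros)
  then have "g i \<in> borel_measurable lebesgue" for i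
    unfolding g_def by (subst borel_measurable_restrict_space_iff[symmetric]) (use \<open>open \<Omega>\<close> in auto)
  then have g: "(\<lambda>x. g i (x + h *\<^sub>R \<nu>)) \<in> borel_measurable lebesgue" for i h
    by (rule measurable_compose[OF measurable_lebesgue_translate])
  have near: "\<exists>r>0. \<forall>h. \<bar>h\<bar> < r \<longrightarrow> h \<in> T x" if "x \<in> \<Omega>" for x
  proof -
    have "0 \<in> T x" using that by (simp add: T_def)
    then obtain r where "r > 0" "ball 0 r \<subseteq> T x" using openT[of x] by (meson openE)
    moreover have "h \<in> ball 0 r" if "\<bar>h\<bar> < r" for h :: real using that by simp
    ultimately show ?thesis by blast
  qed
  \<comment> \<open>Through the countable conditions this set is visibly measurable, which could not
    be read off from \<open>dist_regular\<close>.\<close>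
  define B where "B = \<Omega> \<inter> {x. \<not> rat_regular (\<lambda>i h. g i (x + h *\<^sub>R \<nu>))}"
  have "{x \<in> space lebesgue. rat_regular (\<lambda>i h. g i (x + h *\<^sub>R \<nu>))} \<in> sets lebesgue"
    by (rule sets_rat_regular[OF g])
  then have "space lebesgue - {x \<in> space lebesgue. rat_regular (\<lambda>i h. g i (x + h *\<^sub>R \<nu>))} \<in> sets lebesgue"
    by (rule sets.compl_sets)
  moreover have "\<Omega> \<in> sets lebesgue" using \<open>open \<Omega>\<close> by auto
  ultimately have "\<Omega> \<inter> (space lebesgue - {x \<in> space lebesgue. rat_regular (\<lambda>i h. g i (x + h *\<^sub>R \<nu>))}) \<in> sets lebesgue"
    by (rule sets.Int[rotated])
  moreover have "\<Omega> \<inter> (space lebesgue - {x \<in> space lebesgue. rat_regular (\<lambda>i h. g i (x + h *\<^sub>R \<nu>))}) = B"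
    by (auto simp: B_def)
  ultimately have "B \<in> sets lebesgue" by simp
  moreover have "AE x in lborel. AE t in lborel. x + t *\<^sub>R \<nu> \<notin> B"
    using line
  proof eventually_elim
    case (elim x)
    then have "AE t in lborel. t \<in> T x \<longrightarrow> dist_regular y (\<lambda>h. f (x + (t + h) *\<^sub>R \<nu>))" by blast
    then show ?case
    proof eventually_elim
      case (elim t)
      show ?case
      proof
        assume B: "x + t *\<^sub>R \<nu> \<in> B"
        then have \<Omega>: "x + t *\<^sub>R \<nu> \<in> \<Omega>" by (simp add: B_def)
        obtain r where r: "r > 0" "\<And>h. \<bar>h\<bar> < r \<Longrightarrow> h \<in> T (x + t *\<^sub>R \<nu>)" using near[OF \<Omega>] by blast
        have "dist_regular y (\<lambda>h. f (x + (t + h) *\<^sub>R \<nu>))" using elim \<Omega> by (simp add: T_def)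
        then have "rat_regular (\<lambda>i h. g i (x + t *\<^sub>R \<nu> + h *\<^sub>R \<nu>))"
        proof (rule dist_regular_imp_rat_regular[OF _ r(1)])
          fix i h assume "\<bar>h\<bar> < r"
          then show "g i (x + t *\<^sub>R \<nu> + h *\<^sub>R \<nu>) = dist (f (x + (t + h) *\<^sub>R \<nu>)) (y i)"
            using r(2)[of h] by (simp add: g_def T_def scaleR_left_distrib add.assoc)
        qed
        with B show False by (simp add: B_def)
      qed
    qed
  qed
  ultimately have "B \<in> null_sets lebesgue" by (rule AE_slices_imp_null_sets)
  then have "AE x in lborel. x \<notin> B" using AE_not_in[of B lebesgue] by (simp add: AE_completion_iff)
  with line show ?thesis
  proof eventually_elim
    case (elim x)
    show ?case
    proof
      assume "x \<in> \<Omega>"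
      then obtain r where r: "r > 0" "\<And>h. \<bar>h\<bar> < r \<Longrightarrow> h \<in> T x" using near by blast
      have "rat_regular (\<lambda>i h. g i (x + h *\<^sub>R \<nu>))" using elim(2) \<open>x \<in> \<Omega>\<close> by (simp add: B_def)
      then show "dist_regular y (\<lambda>h. f (x + h *\<^sub>R \<nu>))"
      proof (rule rat_regular_imp_dist_regular[OF _ r(1)])
        show "g i (x + h *\<^sub>R \<nu>) = dist (f (x + h *\<^sub>R \<nu>)) (y i)" if "\<bar>h\<bar> < r" for i h
          using r(2)[OF that] by (simp add: g_def T_def)
        have "{-r<..<r} \<subseteq> T x" using r(2) by auto
        then show "continuous_on {-r<..<r} (\<lambda>h. f (x + h *\<^sub>R \<nu>))"
          using elim(1) continuous_on_subset by blast
        have "0 \<in> T x" using r by simp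
        then show "f (x + 0 *\<^sub>R \<nu>) \<in> closure (range y)" using elim(1) by blast
      qed
    qed
  qed
qed

section \<open>The dual norm at regular points\<close>

lemma dist_regular_metric_dd:
  assumes reg: "dist_regular y (\<lambda>h. f (x + h *\<^sub>R \<nu>))"
  obtains D u where "has_metric_dd f \<nu> x D"
    "\<And>i. ((\<lambda>h. (dist (f (x + h *\<^sub>R \<nu>)) (y i) - dist (f x) (y i)) / h) \<longlongrightarrow> u i) (at 0)"
    "\<And>e. e > 0 \<Longrightarrow> \<exists>i. D \<le> \<bar>u i\<bar> + e"
proof -
  define q where "q i h = (dist (f (x + h *\<^sub>R \<nu>)) (y i) - dist (f x) (y i)) / h" for i h
  define Q where "Q h = dist (f (x + h *\<^sub>R \<nu>)) (f x) / \<bar>h\<bar>" for h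
  obtain u where u: "\<And>i. (q i \<longlongrightarrow> u i) (at 0)"
  proof -
    have "\<forall>i. \<exists>D. (q i \<longlongrightarrow> D) (at 0)" using reg by (simp add: dist_regular_def q_def[abs_def])
    then show ?thesis using that by metis
  qed
  have abs_u: "((\<lambda>h. \<bar>q i h\<bar>) \<longlongrightarrow> \<bar>u i\<bar>) (at 0)" for i using u by (rule tendsto_rabs)
  have low: "\<bar>q i h\<bar> \<le> Q h" for i h
  proof -
    have "\<bar>dist (f (x + h *\<^sub>R \<nu>)) (y i) - dist (f x) (y i)\<bar> \<le> dist (f (x + h *\<^sub>R \<nu>)) (f x)"
      using abs_dist_diff_le[of "f (x + h *\<^sub>R \<nu>)" "y i" "f x"] by (simp add: dist_commute)
    then show ?thesis unfolding q_def Q_def abs_divide by (intro divide_right_mono) auto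
  qed
  have up: "\<exists>i. eventually (\<lambda>h. Q h \<le> \<bar>q i h\<bar> + e) (at 0)" if e: "e > 0" for e
  proof -
    obtain i d where d: "d > 0" "\<And>h. \<bar>h\<bar> < d \<Longrightarrow>
        dist (f (x + h *\<^sub>R \<nu>)) (f x) \<le> \<bar>dist (f (x + h *\<^sub>R \<nu>)) (y i) - dist (f x) (y i)\<bar> + e * \<bar>h\<bar>"
    proof -
      have "\<exists>i. \<exists>d>0. \<forall>h. \<bar>h\<bar> < d \<longrightarrow> dist (f (x + h *\<^sub>R \<nu>)) (f x) \<le>
          \<bar>dist (f (x + h *\<^sub>R \<nu>)) (y i) - dist (f x) (y i)\<bar> + e * \<bar>h\<bar>"
        using reg e by (simp add: dist_regular_def)
      then show ?thesis using that by blast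
    qed
    have "Q h \<le> \<bar>q i h\<bar> + e" if "h \<noteq> 0" "\<bar>h\<bar> < d" for h
    proof -
      have "Q h \<le> (\<bar>dist (f (x + h *\<^sub>R \<nu>)) (y i) - dist (f x) (y i)\<bar> + e * \<bar>h\<bar>) / \<bar>h\<bar>"
        unfolding Q_def using d(2)[OF that(2)] by (rule divide_right_mono) simp
      also have "\<dots> = \<bar>q i h\<bar> + e" using that(1) by (simp add: q_def abs_divide add_divide_distrib)
      finally show ?thesis .
    qed
    then show ?thesis using d(1) unfolding eventually_at dist_real_def by auto
  qed
  \<comment> \<open>A single index is nearly optimal for all \<open>j\<close>: near 0,
    \<open>\<bar>q j h\<bar>\<close> is at most \<open>Q h\<close>, hence at most
    \<open>\<bar>q i h\<bar> + e\<close>, and limits preserve this. It also shows that the supremum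
    \<open>D\<close> is finite.\<close>
  have uu: "\<exists>i. \<forall>j. \<bar>u j\<bar> \<le> \<bar>u i\<bar> + e" if e: "e > 0" for e
  proof -
    obtain i where i: "eventually (\<lambda>h. Q h \<le> \<bar>q i h\<bar> + e) (at 0)" using up[OF e] by blast
    have "\<bar>u j\<bar> \<le> \<bar>u i\<bar> + e" for j
    proof (rule tendsto_le[OF _ _ abs_u[of j]])
      show "((\<lambda>h. \<bar>q i h\<bar> + e) \<longlongrightarrow> \<bar>u i\<bar> + e) (at 0)" by (intro tendsto_add abs_u tendsto_const)
      show "eventually (\<lambda>h. \<bar>q j h\<bar> \<le> \<bar>q i h\<bar> + e) (at 0)"
        using i by eventually_elim (use low in \<open>blast intro: order_trans\<close>)
    qed simp
    then show ?thesis by blast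
  qed
  define D where "D = (SUP i. \<bar>u i\<bar>)"
  obtain i1 where "\<bar>u j\<bar> \<le> \<bar>u i1\<bar> + 1" for j using uu[OF zero_less_one] by blast
  then have "bdd_above (range (\<lambda>i. \<bar>u i\<bar>))" by (intro bdd_aboveI[of _ "\<bar>u i1\<bar> + 1"]) blast
  then have uD: "\<bar>u i\<bar> \<le> D" for i unfolding D_def by (rule cSUP_upper[rotated]) simp
  have Du: "\<exists>i. D \<le> \<bar>u i\<bar> + e" if "e > 0" for e
    using uu[OF that] unfolding D_def by (metis cSUP_least UNIV_not_empty)
  have "(Q \<longlongrightarrow> D) (at 0)"
    unfolding tendsto_iff
  proof (intro allI impI)
    fix e :: real assume "e > 0"
    then have e4: "e / 4 > 0" by simp
    \<comment> \<open>\<open>i\<close> bounds \<open>Q\<close> from above through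
      \<open>\<bar>u i\<bar> \<le> D\<close>; \<open>j\<close> nearly attains \<open>D\<close> and
      bounds \<open>Q\<close> from below.\<close>
    obtain i where i: "eventually (\<lambda>h. Q h \<le> \<bar>q i h\<bar> + e / 4) (at 0)" using up[OF e4] by blast
    obtain j where j: "D \<le> \<bar>u j\<bar> + e / 4" using Du[OF e4] by blast
    show "eventually (\<lambda>h. dist (Q h) D < e) (at 0)"
      using i tendstoD[OF abs_u[of i] e4] tendstoD[OF abs_u[of j] e4]
    proof eventually_elim
      case (elim h)
      have "\<bar>q i h\<bar> < \<bar>u i\<bar> + e / 4" "\<bar>u j\<bar> < \<bar>q j h\<bar> + e / 4"
        using elim(2,3) unfolding dist_real_def abs_diff_less_iff by linarith+
      then have "Q h < D + e" "D - e < Q h" using elim(1) uD[of i] j low[of j h] \<open>e > 0\<close> by simp_all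
      then show ?case by (simp add: dist_real_def abs_diff_less_iff)
    qed
  qed
  then show thesis using that[of D u] u Du unfolding has_metric_dd_def Q_def[abs_def] q_def[abs_def] by blast
qed

text \<open>Distance functions are 1-Lipschitz; the subtracted constant makes them vanish at
  \<open>z0\<close> without touching their difference quotients.\<close>

lemma Lip0_dist:
  shows "(\<lambda>v. dist v a - dist z0 a) \<in> Lip0 z0" "Lip_norm (\<lambda>v. dist v a - dist z0 a) \<le> 1"
proof -
  have "1-lipschitz_on UNIV (\<lambda>v. dist v a - dist z0 a)"
  proof (rule lipschitz_onI)
    show "dist (dist v a - dist z0 a) (dist w a - dist z0 a) \<le> 1 * dist v w" for v w
      using abs_dist_diff_le[of v a w] by (simp add: dist_real_def dist_commute)
  qed simp
  then show "(\<lambda>v. dist v a - dist z0 a) \<in> Lip0 z0" "Lip_norm (\<lambda>v. dist v a - dist z0 a) \<le> 1"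
    by (auto simp: Lip0_def intro: Lip_norm_le)
qed

lemma Lip0_dual_norm_weak_dd:
  fixes f :: "real^'n \<Rightarrow> 'x::metric_space"
  assumes bl: "banach_limit \<Phi>" and \<delta>: "\<And>m. 0 < \<delta> m" "\<delta> \<longlonglongrightarrow> 0"
    and "open \<Omega>" "x \<in> \<Omega>" and D: "has_metric_dd f \<nu> x D"
    and u: "\<And>i. ((\<lambda>h. (dist (f (x + h *\<^sub>R \<nu>)) (y i) - dist (f x) (y i)) / h) \<longlongrightarrow> u i) (at 0)"
    and Du: "\<And>e. e > 0 \<Longrightarrow> \<exists>i. D \<le> \<bar>u i\<bar> + e"
  shows "Lip0_dual_norm z0 (weak_dd \<Phi> \<delta> z0 \<Omega> f \<nu> x) = D"
proof -
  let ?q = "weak_dd_quot \<delta> \<Omega> f \<nu> x"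
  have w: "weak_dd_bounded z0 f \<nu> x" by (rule has_metric_dd_imp_weak_dd_bounded[OF D])
  have W: "weak_dd \<Phi> \<delta> z0 \<Omega> f \<nu> x = (\<lambda>\<phi>. \<Phi> (Bcontfun (?q \<phi>)))"
    using w by (simp add: weak_dd_def)
  have inv: "apply_bcontfun (Bcontfun (?q \<phi>)) = ?q \<phi>" if "\<phi> \<in> Lip0 z0" for \<phi>
    by (rule Bcontfun_inverse[OF weak_dd_quot_bcontfun[OF \<delta> w that]])
  have \<delta>0: "filterlim \<delta> (at 0) sequentially"
    using \<delta> by (auto simp: filterlim_at intro!: always_eventually less_imp_neq[symmetric])
  have up: "\<bar>\<Phi> (Bcontfun (?q \<phi>))\<bar> \<le> D" if \<phi>: "\<phi> \<in> Lip0 z0" "Lip_norm \<phi> \<le> 1" for \<phi>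
  proof (rule field_le_epsilon)
    fix e :: real assume "e > 0"
    have "((\<lambda>m. dist (f (x + \<delta> m *\<^sub>R \<nu>)) (f x) / \<bar>\<delta> m\<bar>) \<longlongrightarrow> D) sequentially"
      using D \<delta>0 unfolding has_metric_dd_def by (rule filterlim_compose)
    then have "eventually (\<lambda>m. dist (f (x + \<delta> m *\<^sub>R \<nu>)) (f x) / \<bar>\<delta> m\<bar> < D + e) sequentially"
      using \<open>e > 0\<close> by (intro order_tendstoD(2)) auto
    then have "eventually (\<lambda>m. \<bar>?q \<phi> m\<bar> \<le> D + e) sequentially"
    proof eventually_elim
      case (elim m)
      obtain C where C: "C-lipschitz_on UNIV \<phi>" using \<phi>(1) by (auto simp: Lip0_def)
      have "\<bar>\<phi> (f (x + \<delta> m *\<^sub>R \<nu>)) - \<phi> (f x)\<bar> \<le> Lip_norm \<phi> * dist (f (x + \<delta> m *\<^sub>R \<nu>)) (f x)"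
        by (rule Lip_norm_bound[OF C])
      also have "\<dots> \<le> 1 * dist (f (x + \<delta> m *\<^sub>R \<nu>)) (f x)" using \<phi>(2) by (intro mult_right_mono) auto
      finally have "\<bar>\<phi> (f (x + \<delta> m *\<^sub>R \<nu>)) - \<phi> (f x)\<bar> / \<bar>\<delta> m\<bar> \<le> dist (f (x + \<delta> m *\<^sub>R \<nu>)) (f x) / \<bar>\<delta> m\<bar>"
        by (intro divide_right_mono) auto
      \<comment> \<open>Where the point leaves \<open>\<Omega>\<close> the quotient is 0 by
        definition and the bound is trivial.\<close>
      then have "\<bar>?q \<phi> m\<bar> \<le> dist (f (x + \<delta> m *\<^sub>R \<nu>)) (f x) / \<bar>\<delta> m\<bar>"
        by (simp add: weak_dd_quot_def)
      with elim show ?case by linarith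
    qed
    then show "\<bar>\<Phi> (Bcontfun (?q \<phi>))\<bar> \<le> D + e"
      by (intro banach_limit_le[OF bl]) (simp add: inv \<phi>)
  qed
  let ?\<phi> = "\<lambda>i v. dist v (y i) - dist z0 (y i)"
  have val: "\<Phi> (Bcontfun (?q (?\<phi> i))) = u i" for i
  proof -
    have "(\<lambda>m. (dist (f (x + \<delta> m *\<^sub>R \<nu>)) (y i) - dist (f x) (y i)) / \<delta> m) \<longlonglongrightarrow> u i"
      using u \<delta>0 by (rule filterlim_compose)
    \<comment> \<open>Here the default value 0 could spoil the limit; openness of
      \<open>\<Omega>\<close> excludes it for large \<open>m\<close>.\<close>
    moreover have "(\<lambda>m. x + \<delta> m *\<^sub>R \<nu>) \<longlonglongrightarrow> x + 0 *\<^sub>R \<nu>" by (intro tendsto_intros \<delta>(2))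
    then have "eventually (\<lambda>m. x + \<delta> m *\<^sub>R \<nu> \<in> \<Omega>) sequentially"
      using \<open>open \<Omega>\<close> \<open>x \<in> \<Omega>\<close> by (auto dest: topological_tendstoD)
    then have "eventually (\<lambda>m. (dist (f (x + \<delta> m *\<^sub>R \<nu>)) (y i) - dist (f x) (y i)) / \<delta> m = ?q (?\<phi> i) m) sequentially"
      by eventually_elim (simp add: weak_dd_quot_def)
    ultimately have "?q (?\<phi> i) \<longlonglongrightarrow> u i" by (rule Lim_transform_eventually)
    then show ?thesis using bl inv[OF Lip0_dist(1)] unfolding banach_limit_def by metis
  qed
  let ?S = "{\<phi> \<in> Lip0 z0. Lip_norm \<phi> \<le> 1}"
  have S: "?\<phi> i \<in> ?S" for i using Lip0_dist by blast
  have "(SUP \<phi>\<in>?S. \<bar>\<Phi> (Bcontfun (?q \<phi>))\<bar>) = D"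
  proof (rule antisym)
    show "(SUP \<phi>\<in>?S. \<bar>\<Phi> (Bcontfun (?q \<phi>))\<bar>) \<le> D"
      by (rule cSUP_least) (use S up in auto)
    show "D \<le> (SUP \<phi>\<in>?S. \<bar>\<Phi> (Bcontfun (?q \<phi>))\<bar>)"
    proof (rule field_le_epsilon)
      fix e :: real assume "e > 0"
      then obtain i where "D \<le> \<bar>u i\<bar> + e" using Du by blast
      moreover have "\<bar>\<Phi> (Bcontfun (?q (?\<phi> i)))\<bar> \<le> (SUP \<phi>\<in>?S. \<bar>\<Phi> (Bcontfun (?q \<phi>))\<bar>)"
        by (rule cSUP_upper[OF S]) (use up in \<open>auto intro!: bdd_aboveI[of _ D]\<close>)
      ultimately show "D \<le> (SUP \<phi>\<in>?S. \<bar>\<Phi> (Bcontfun (?q \<phi>))\<bar>) + e" unfolding val by linarith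
    qed
  qed
  then show ?thesis by (simp add: Lip0_dual_norm_def W)
qed

text \<open>The conclusion also certifies that the limit exists and that the functional is bounded:
  \<open>metric_dd\<close> is a \<open>Lim\<close> and the dual norm a real supremum, which would be
  unspecified values otherwise.\<close>

theorem theorem3p5:
  fixes \<Omega> :: "(real^'n) set"
    and z0 :: "'x::complete_space"
    and \<nu> :: "real^'n"
    and f :: "real^'n \<Rightarrow> 'x"
    and \<Phi> :: "(nat \<Rightarrow>\<^sub>C real) \<Rightarrow> real"
    and \<delta> :: "nat \<Rightarrow> real"
  assumes "banach_limit \<Phi>"
    and "\<And>m. 0 < \<delta> m" and "\<delta> \<longlonglongrightarrow> 0"
    and "open \<Omega>"
    and "\<nu> \<noteq> 0"
    and "f \<in> measurable (lebesgue_on \<Omega>) borel"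
    and "ess_separably_valued \<Omega> f"
    and "abs_cont_on_ae_segment \<Omega> \<nu> f"
    and "locally_integrable_on (metric_dd f \<nu>) \<Omega>"
  shows "AE x in lebesgue_on \<Omega>.
    has_metric_dd f \<nu> x (metric_dd f \<nu> x) \<and>
    weak_dd \<Phi> \<delta> z0 \<Omega> f \<nu> x \<in> Lip0_dual z0 \<and>
    Lip0_dual_norm z0 (weak_dd \<Phi> \<delta> z0 \<Omega> f \<nu> x) = metric_dd f \<nu> x"
proof -
  obtain N and y :: "nat \<Rightarrow> 'x" where N: "N \<in> null_sets lebesgue" "f ` (\<Omega> - N) \<subseteq> closure (range y)"
    by (rule ess_separably_valuedE[OF assms(7)])
  have "AE x in lebesgue. x \<in> \<Omega> \<longrightarrow> dist_regular y (\<lambda>h. f (x + h *\<^sub>R \<nu>))"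
    using AE_dist_regular[OF assms(4,6) N assms(8)] by (rule AE_completion)
  moreover have "\<Omega> \<inter> space lebesgue \<in> sets lebesgue" using assms(4) by auto
  ultimately have "AE x in lebesgue_on \<Omega>. x \<in> \<Omega> \<and> dist_regular y (\<lambda>h. f (x + h *\<^sub>R \<nu>))"
    by (simp add: AE_restrict_space_iff)
  then show ?thesis
  proof eventually_elim
    case (elim x)
    obtain D u where D: "has_metric_dd f \<nu> x D"
      and u: "\<And>i. ((\<lambda>h. (dist (f (x + h *\<^sub>R \<nu>)) (y i) - dist (f x) (y i)) / h) \<longlongrightarrow> u i) (at 0)"
      and Du: "\<And>e. e > 0 \<Longrightarrow> \<exists>i. D \<le> \<bar>u i\<bar> + e"
      using elim by (elim conjE dist_regular_metric_dd) (rule that)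
    have "metric_dd f \<nu> x = D"
      unfolding metric_dd_def by (rule tendsto_Lim) (use D in \<open>simp_all add: has_metric_dd_def\<close>)
    moreover have "Lip0_dual_norm z0 (weak_dd \<Phi> \<delta> z0 \<Omega> f \<nu> x) = D"
      using elim by (intro Lip0_dual_norm_weak_dd[OF assms(1-4) _ D u Du]) auto
    moreover have "weak_dd \<Phi> \<delta> z0 \<Omega> f \<nu> x \<in> Lip0_dual z0"
      by (rule weak_dd_in_Lip0_dual[OF assms(1-3) has_metric_dd_imp_weak_dd_bounded[OF D]])
    ultimately show ?case using D by simp
  qed
qed

end
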